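(* Let $m\ge1$, $n\ge4$, let $\mathbf r=(r_1,\dots,r_n)$ be positive real numbers, and let $1\le i\le n-3$, $1\le j\le m+1$. On the open subset of $\widetilde N_{\mathbf r}=\prod_k\mathcal O_{r_k}$ where $\lambda_{ij}$ is a simple eigenvalue of $A_i=e_1+\cdots+e_{i+1}$, the Hamiltonian flow $\phi_{ij}^t$ of $\lambda_{ij}$ has period $2\pi$ in $t$, i.e. $\phi_{ij}^{t+2\pi}=\phi_{ij}^t$.
   Context: For a unit vector $w\in\mathbb C^{m+1}$, $w\otimes w^*$ is the projection $v\mapsto(v,w)w$; $\mathcal O_r=\{r\,w\otimes w^*:\|w\|=1\}\subset\mathcal H_{m+1}$ (Hermitian $(m+1)\times(m+1)$ matrices). $\lambda_{i1}\ge\cdots\ge\lambda_{i,m+1}$ are the eigenvalues of $A_i$, as functions of $\mathbf e\in\widetilde N_{\mathbf r}$. Symplectic conventions: the gradient $\nabla f(X)\in\mathfrak u(m+1)$ of a function $f$ on $\mathcal H_{m+1}$ is defined by $\operatorname{Im}\operatorname{Tr}(\nabla f(X)Y)=\frac{d}{dt}|_{t=0}f(X+tY)$. Each orbit carries the Kostant–Kirillov form $\omega(X)([\xi,X],[\eta,X])=\operatorname{Im}\operatorname{Tr}(X[\xi,\eta])$, with Hamilton's equations $\dot X=[\nabla f(X),X]$; $\widetilde N_{\mathbf r}$ has the product symplectic structure, so the Hamiltonian system of $f$ on $\widetilde N_{\mathbf r}$ is $\dot e_k=[\nabla_kf,e_k]$ for $1\le k\le n$, with $\nabla_k$ the gradient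 in the variable $e_k$. *)

theory Defs
  imports "HOL-Analysis.Analysis" "HOL-Computational_Algebra.Computational_Algebra"
begin

section \<open>Hermitian matrices and their ordered eigenvalues\<close>

definition adjoint_matrix :: "complex^'d^'d \<Rightarrow> complex^'d^'d" where
  "adjoint_matrix A = (\<chi> a b. cnj (A $ b $ a))"

definition hermitian :: "complex^'d^'d \<Rightarrow> bool" where
  "hermitian A \<longleftrightarrow> adjoint_matrix A = A"

text \<open>The Lie algebra of the unitary group.\<close>

definition skew_hermitian :: "complex^'d^'d \<Rightarrow> bool" where
  "skew_hermitian A \<longleftrightarrow> adjoint_matrix A = - A"

definition commutator :: "complex^'d^'d \<Rightarrow> complex^'d^'d \<Rightarrow> complex^'d^'d" where
  "commutator A B = A ** B - B ** A"

text \<open>The determinant of \<open>x 1 - A\<close>, computed over the polynomial ring.\<close>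

definition charpoly :: "complex^'d^'d \<Rightarrow> complex poly" where
  "charpoly A = det (\<chi> a b. [: - (A $ a $ b), if a = b then 1 else 0 :])"

text \<open>
  The \<open>j\<close>-th largest eigenvalue, counted with multiplicity, for \<open>1 \<le> j \<le> CARD('d)\<close>. It is
  meant for Hermitian matrices only, where all roots of the characteristic polynomial are real, so
  that taking real parts loses nothing.
\<close>

definition ordered_eigenvalue :: "complex^'d^'d \<Rightarrow> nat \<Rightarrow> real" where
  "ordered_eigenvalue A j =
     rev (sorted_list_of_multiset (image_mset Re (proots (charpoly A)))) ! (j - 1)"

definition simple_eigenvalue :: "complex^'d^'d \<Rightarrow> complex \<Rightarrow> bool" where
  "simple_eigenvalue A x \<longleftrightarrow> count (proots (charpoly A)) x = 1"

section \<open>Products of orbits\<close>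

text \<open>The matrix of the map sending \<open>v\<close> to \<open>(v, w) w\<close>, where \<open>(v, w)\<close> is the sum of
  \<open>v\<^sub>b * cnj w\<^sub>b\<close>.\<close>

definition rank_one :: "complex^'d \<Rightarrow> complex^'d^'d" where
  "rank_one w = (\<chi> a b. w $ a * cnj (w $ b))"

definition orbit :: "real \<Rightarrow> (complex^'d^'d) set" where
  "orbit r = {r *\<^sub>R rank_one w | w. norm w = 1}"

text \<open>Tuples are indexed by \<open>1, \<dots>, n\<close> and are \<open>undefined\<close> elsewhere.\<close>

definition orbit_product :: "nat \<Rightarrow> (nat \<Rightarrow> real) \<Rightarrow> (nat \<Rightarrow> complex^'d^'d) set" where
  "orbit_product n r = (\<Pi>\<^sub>E k\<in>{1..n}. orbit (r k))"

definition partial_sum :: "nat \<Rightarrow> (nat \<Rightarrow> complex^'d^'d) \<Rightarrow> complex^'d^'d" where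
  "partial_sum i e = (\<Sum>k\<in>{1..i+1}. e k)"

definition lam :: "nat \<Rightarrow> nat \<Rightarrow> (nat \<Rightarrow> complex^'d^'d) \<Rightarrow> real" where
  "lam i j e = ordered_eigenvalue (partial_sum i e) j"

definition simple_locus ::
  "nat \<Rightarrow> (nat \<Rightarrow> real) \<Rightarrow> nat \<Rightarrow> nat \<Rightarrow> (nat \<Rightarrow> complex^'d^'d) set" where
  "simple_locus n r i j =
     {e \<in> orbit_product n r. simple_eigenvalue (partial_sum i e) (complex_of_real (lam i j e))}"

section \<open>Hamiltonian systems\<close>

text \<open>\<open>has_gradient f X G\<close> says that \<open>G\<close> is the gradient at \<open>X\<close> of the function \<open>f\<close> on Hermitian
  matrices; a gradient is unique if it exists.\<close>

definition has_gradient ::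
  "(complex^'d^'d \<Rightarrow> real) \<Rightarrow> complex^'d^'d \<Rightarrow> complex^'d^'d \<Rightarrow> bool" where
  "has_gradient f X G \<longleftrightarrow> skew_hermitian G \<and>
     (\<forall>Y. hermitian Y \<longrightarrow>
       ((\<lambda>t. f (X + t *\<^sub>R Y)) has_real_derivative Im (trace (G ** Y))) (at 0))"

text \<open>\<open>kirillov_form X \<xi> \<eta>\<close> is the value of the Kostant--Kirillov form at \<open>X\<close> on the tangent vectors
  \<open>[\<xi>, X]\<close> and \<open>[\<eta>, X]\<close>. The lemma says that contracting this form with \<open>[\<nabla>f(X), X]\<close> gives the
  differential of \<open>f\<close>, which is why Hamilton's equations below are the commutator equations.\<close>

definition kirillov_form ::
  "complex^'d^'d \<Rightarrow> complex^'d^'d \<Rightarrow> complex^'d^'d \<Rightarrow> real" where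
  "kirillov_form X \<xi> \<eta> = Im (trace (X ** commutator \<xi> \<eta>))"

lemma kirillov_form_gradient:
  fixes X G \<eta> :: "complex^'d^'d"
  assumes "has_gradient f X G" "hermitian X" "skew_hermitian \<eta>"
  shows "((\<lambda>t. f (X + t *\<^sub>R commutator \<eta> X)) has_real_derivative kirillov_form X G \<eta>) (at 0)"
proof -
  have adj_mult: "adjoint_matrix (A ** B) = adjoint_matrix B ** adjoint_matrix A"
    for A B :: "complex^'d^'d"
    by (simp add: adjoint_matrix_def matrix_matrix_mult_def vec_eq_iff mult.commute)
  have adj_diff: "adjoint_matrix (A - B) = adjoint_matrix A - adjoint_matrix B"
    for A B :: "complex^'d^'d"
    by (simp add: adjoint_matrix_def vec_eq_iff)
  have neg: "(- A) ** B = - (A ** B)" "A ** (- B) = - (A ** B)" for A B :: "complex^'d^'d"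
    by (simp_all add: matrix_matrix_mult_def vec_eq_iff sum_negf)
  have herm: "hermitian (commutator \<eta> X)"
    using assms(2,3)
    by (simp add: hermitian_def skew_hermitian_def commutator_def adj_diff adj_mult neg)
  have sub: "A ** (B - C) = A ** B - A ** C" for A B C :: "complex^'d^'d"
    by (simp add: matrix_matrix_mult_def vec_eq_iff sum_subtractf right_diff_distrib)
  have "trace (X ** (G ** \<eta>)) = trace (G ** (\<eta> ** X))"
    by (metis matrix_mul_assoc trace_mul_sym)
  moreover have "trace (X ** (\<eta> ** G)) = trace (G ** (X ** \<eta>))"
    by (metis matrix_mul_assoc trace_mul_sym)
  ultimately have "trace (X ** commutator G \<eta>) = trace (G ** commutator \<eta> X)"
    by (simp add: commutator_def sub trace_sub)
  then show ?thesis
    using assms(1) herm by (simp add: has_gradient_def kirillov_form_def)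
qed

text \<open>Integral curves in \<open>U\<close>, defined on an open interval \<open>J\<close>, of the Hamiltonian system of \<open>f\<close>; the
  witness \<open>G\<close> is the gradient of \<open>f\<close> in the \<open>k\<close>-th variable.\<close>

definition hamiltonian_curve ::
  "nat \<Rightarrow> ((nat \<Rightarrow> complex^'d^'d) \<Rightarrow> real) \<Rightarrow> (nat \<Rightarrow> complex^'d^'d) set \<Rightarrow> real set \<Rightarrow>
   (real \<Rightarrow> nat \<Rightarrow> complex^'d^'d) \<Rightarrow> bool" where
  "hamiltonian_curve n f U J c \<longleftrightarrow> open J \<and> is_interval J \<and>
     (\<forall>t\<in>J. c t \<in> U \<and>
       (\<forall>k\<in>{1..n}. \<exists>G. has_gradient (\<lambda>X. f ((c t)(k := X))) (c t k) G \<and>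
          ((\<lambda>s. c s k) has_vector_derivative commutator G (c t k)) (at t)))"

text \<open>\<open>\<phi> t e\<close>, for \<open>e \<in> U\<close>, is the Hamiltonian flow of \<open>f\<close> on \<open>U\<close>: it is defined for all times, and
  every integral curve in \<open>U\<close> is part of a trajectory of \<open>\<phi>\<close>. This determines \<open>\<phi>\<close> on \<open>U\<close>.\<close>

definition hamiltonian_flow ::
  "nat \<Rightarrow> ((nat \<Rightarrow> complex^'d^'d) \<Rightarrow> real) \<Rightarrow> (nat \<Rightarrow> complex^'d^'d) set \<Rightarrow>
   (real \<Rightarrow> (nat \<Rightarrow> complex^'d^'d) \<Rightarrow> nat \<Rightarrow> complex^'d^'d) \<Rightarrow> bool" where
  "hamiltonian_flow n f U \<phi> \<longleftrightarrow>
     (\<forall>e\<in>U. \<phi> 0 e = e \<and> hamiltonian_curve n f U UNIV (\<lambda>t. \<phi> t e) \<and>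
        (\<forall>J c. hamiltonian_curve n f U J c \<and> 0 \<in> J \<and> c 0 = e \<longrightarrow> (\<forall>t\<in>J. c t = \<phi> t e)))"

end

(* The gradient of a simple eigenvalue of A_i in each of e_1, ..., e_{i+1} is Q = i P, with P the
   orthogonal projection onto the eigenline, and it is 0 in the other variables. Along the flow A_i
   moves by [Q, A_i] = 0, so P is constant and the flow conjugates e_1, ..., e_{i+1} by
   exp(t Q) = 1 + (exp(i t) - 1) P, which is 2 pi-periodic. That the ordered eigenvalue is
   differentiable with this gradient, and that simplicity is an open condition, follows from the
   Lipschitz continuity of ordered eigenvalues (counting dimensions) and from the spectral gap. *)

theory Submission
  imports Defs
begin

section \<open>The Hermitian inner product\<close>

text \<open>\<open>ordered_eigenvalue\<close> is a position in a sorted list of roots, so no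
  regularity in the matrix is built in. Sorting is therefore traded for counting: the value is at
  least \<open>c\<close> iff at least \<open>j\<close> eigenvalues are. \<open>has_gradient\<close>
  asks only for derivatives at \<open>t = 0\<close> along lines \<open>A + t Y\<close>, so a
  remainder O(t^2) at one point suffices; the Lipschitz bound locates the perturbed eigenvalue, and
  the gap keeps its eigenvector near the old one. The other obstacle is the clause of
  \<open>hamiltonian_flow\<close> on arbitrary integral curves, whose gradients are existential
  witnesses and whose equation is nonlinear, as Q depends on the point. Uniqueness of gradients
  identifies the witnesses; summing the equations then freezes Q before anything is solved, and what
  remains is linear with constant coefficients. Eigenvectors carry an arbitrary phase. It cancels in
  P, and the chosen eigenvector is a function of A_i alone, hence stays the same along the
  flow.\<close>

definition cinner :: "complex^'d \<Rightarrow> complex^'d \<Rightarrow> complex" where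
  "cinner x y = (\<Sum>b\<in>UNIV. x $ b * cnj (y $ b))"

lemma cinner_add_left: "cinner (x + y) z = cinner x z + cinner y z"
  by (simp add: cinner_def distrib_right sum.distrib)

lemma cinner_diff_left: "cinner (x - y) z = cinner x z - cinner y z"
  by (simp add: cinner_def left_diff_distrib sum_subtractf)

lemma cinner_scale_left: "cinner (c *s x) z = c * cinner x z"
  by (simp add: cinner_def sum_distrib_left mult.assoc)

lemma cinner_zero_left [simp]: "cinner 0 z = 0"
  by (simp add: cinner_def)

lemma cinner_sum_left: "cinner (\<Sum>k\<in>K. f k) z = (\<Sum>k\<in>K. cinner (f k) z)"
  by (induction K rule: infinite_finite_induct) (simp_all add: cinner_add_left)

lemma cinner_commute: "cinner x y = cnj (cinner y x)"
  by (simp add: cinner_def mult.commute)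

lemma cinner_eq_0_commute: "cinner x y = 0 \<longleftrightarrow> cinner y x = 0"
  by (metis cinner_commute complex_cnj_zero_iff)

lemma cinner_scale_right: "cinner z (c *s x) = cnj c * cinner z x"
  by (simp add: cinner_def sum_distrib_left mult_ac)

lemma cinner_self: "cinner x x = of_real ((norm x)\<^sup>2)"
  by (simp add: cinner_def norm_vec_def L2_set_def sum_nonneg complex_mult_cnj cmod_power2)

lemma Re_cinner: "Re (cinner x y) = x \<bullet> y"
  by (simp add: cinner_def inner_vec_def inner_complex_def)

lemma norm_scale: "norm (c *s x) = cmod c * norm (x :: complex^'d)"
proof -
  have "complex_of_real ((norm (c *s x))\<^sup>2) = (c * cnj c) * cinner x x"
    unfolding cinner_self [symmetric] by (simp add: cinner_scale_left cinner_scale_right)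
  also have "\<dots> = complex_of_real ((cmod c * norm x)\<^sup>2)"
    unfolding cinner_self power_mult_distrib of_real_mult complex_norm_square [symmetric] by simp
  finally have "complex_of_real ((norm (c *s x))\<^sup>2) = complex_of_real ((cmod c * norm x)\<^sup>2)" .
  then show ?thesis
    by (metis norm_ge_zero of_real_eq_iff power2_eq_imp_eq mult_nonneg_nonneg)
qed

text \<open>Multiplying \<open>x\<close> by a phase \<open>c\<close> turns the inner product into
  its modulus, a real number; there it agrees with the real inner product, and the real
  Cauchy-Schwarz inequality applies.\<close>

lemma norm_cinner_le: "cmod (cinner x y) \<le> norm x * norm y"
proof (cases "cinner x y = 0")
  case False
  define z where "z = cinner x y"
  define c where "c = cnj z / of_real (cmod z)"
  have c: "cmod c = 1"
    using False by (simp add: c_def z_def norm_divide)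
  have "c * z = of_real (cmod z)"
  proof -
    have "c * z = of_real ((cmod z)\<^sup>2) / of_real (cmod z)"
      unfolding complex_norm_square by (simp add: c_def mult.commute)
    then show ?thesis
      using False by (simp add: z_def power2_eq_square)
  qed
  then have "cinner (c *s x) y = of_real (cmod (cinner x y))"
    by (simp add: cinner_scale_left z_def)
  then have "cmod (cinner x y) = (c *s x) \<bullet> y"
    by (metis Re_cinner Re_complex_of_real)
  also have "\<dots> \<le> norm (c *s x) * norm y"
    by (rule norm_cauchy_schwarz)
  finally show ?thesis
    by (simp add: norm_scale c)
qed simp

lemma scaleR_eq_scale: "(t :: real) *\<^sub>R x = of_real t *s (x :: complex^'d)"
  by (simp add: vec_eq_iff) (simp add: scaleR_conv_of_real)

lemma cinner_matrix_left: "cinner (A *v x) y = cinner x (adjoint_matrix A *v y)"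
proof -
  have "cinner (A *v x) y = (\<Sum>a\<in>UNIV. \<Sum>b\<in>UNIV. A $ a $ b * x $ b * cnj (y $ a))"
    by (simp add: cinner_def matrix_vector_mult_def sum_distrib_right)
  also have "\<dots> = (\<Sum>b\<in>UNIV. \<Sum>a\<in>UNIV. A $ a $ b * x $ b * cnj (y $ a))"
    by (rule sum.swap)
  also have "\<dots> = cinner x (adjoint_matrix A *v y)"
    by (simp add: cinner_def matrix_vector_mult_def adjoint_matrix_def sum_distrib_left mult_ac)
  finally show ?thesis .
qed

lemma cinner_hermitian: "hermitian A \<Longrightarrow> cinner (A *v x) y = cinner x (A *v y)"
  by (simp add: cinner_matrix_left hermitian_def)

text \<open>The norm of a matrix is here the Euclidean norm of its entries. Cauchy-Schwarz bounds
  each coordinate by a row; adding up the coordinates costs the factor \<open>CARD('d)\<close>,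
  which is crude but harmless, since any Lipschitz constant will do.\<close>

lemma norm_matrix_vector_le:
  fixes A :: "complex^'d^'d"
  shows "norm (A *v x) \<le> real CARD('d) * norm A * norm x"
proof -
  have row: "cmod ((A *v x) $ a) \<le> norm A * norm x" for a
  proof -
    have "(A *v x) $ a = cinner x (\<chi> b. cnj (A $ a $ b))"
      by (simp add: cinner_def matrix_vector_mult_def mult.commute)
    then have "cmod ((A *v x) $ a) \<le> norm x * norm (\<chi> b. cnj (A $ a $ b))"
      by (simp only: norm_cinner_le)
    also have "norm (\<chi> b. cnj (A $ a $ b)) = norm (A $ a)"
      by (simp add: norm_vec_def)
    also have "norm x * norm (A $ a) \<le> norm x * norm A"
      by (intro mult_left_mono Finite_Cartesian_Product.norm_nth_le) simp
    finally show ?thesis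
      by (simp only: mult.commute)
  qed
  have "norm (A *v x) \<le> (\<Sum>a\<in>UNIV. cmod ((A *v x) $ a))"
    unfolding norm_vec_def by (rule L2_set_le_sum) simp
  also have "\<dots> \<le> (\<Sum>a\<in>(UNIV::'d set). norm A * norm x)"
    by (intro sum_mono row)
  finally show ?thesis
    by simp
qed

lemma scaleR_matrix_vector: "(t *\<^sub>R A) *v x = t *\<^sub>R (A *v x)" for A :: "complex^'d^'d"
  by (simp add: vec_eq_iff matrix_vector_mult_def scaleR_sum_right)

section \<open>The spectral theorem\<close>

definition orthonormal_on :: "'k set \<Rightarrow> ('k \<Rightarrow> complex^'d) \<Rightarrow> bool" where
  "orthonormal_on K u \<longleftrightarrow> (\<forall>k\<in>K. \<forall>l\<in>K. cinner (u k) (u l) = (if k = l then 1 else 0))"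

definition eigenbasis :: "complex^'d^'d \<Rightarrow> ('d \<Rightarrow> complex^'d) \<Rightarrow> ('d \<Rightarrow> real) \<Rightarrow> bool" where
  "eigenbasis A u \<alpha> \<longleftrightarrow> orthonormal_on UNIV u \<and> (\<forall>k. A *v u k = of_real (\<alpha> k) *s u k)"

definition orthocomplement :: "(complex^'d) set \<Rightarrow> (complex^'d) set" where
  "orthocomplement S = {x. \<forall>y\<in>S. cinner x y = 0}"

text \<open>Fewer equations than unknowns: the conjugated vectors of \<open>F\<close> become rows of
  a square matrix with at least one zero row \<open>a\<close>. It misses \<open>axis a 1\<close>, so
  it is not surjective, hence not injective, and a kernel vector is orthogonal to
  \<open>F\<close>.\<close>

lemma orthocomplement_nontrivial:
  fixes F :: "(complex^'d) set"
  assumes "finite F" "card F < CARD('d)"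
  shows "\<exists>x. x \<noteq> 0 \<and> x \<in> orthocomplement F"
proof -
  fix a :: 'd
  have "card F \<le> card (UNIV - {a})"
    using assms(2) by (simp add: card_Diff_singleton)
  then obtain g where g: "g ` F \<subseteq> UNIV - {a}" "inj_on g F"
    using card_le_inj [OF assms(1)] by (metis finite)
  define M :: "complex^'d^'d" where
    "M = (\<chi> i b. if i \<in> g ` F then cnj (inv_into F g i $ b) else 0)"
  have M: "(M *v x) $ g y = cinner x y" if "y \<in> F" for x y
    using g(2) that by (simp add: M_def matrix_vector_mult_def cinner_def mult.commute)
  have "(M *v x) $ a = 0" for x
  proof -
    have "a \<notin> g ` F"
      using g(1) by blast
    then show ?thesis
      by (simp add: M_def matrix_vector_mult_def)
  qed
  then have "M *v x \<noteq> axis a 1" for x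
    by (metis axis_nth zero_neq_one)
  then have "\<not> surj ((*v) M)"
    by (metis surjD)
  then have "\<not> inj ((*v) M)"
    using vec.linear_injective_imp_surjective matrix_vector_mul_linear_gen by blast
  then obtain x y where "x \<noteq> y" "M *v x = M *v y"
    by (auto simp: inj_def)
  then have "x - y \<noteq> 0" "M *v (x - y) = 0"
    by (simp_all add: matrix_vector_mult_diff_distrib)
  moreover from this have "x - y \<in> orthocomplement F"
    using M [of _ "x - y"] by (simp add: orthocomplement_def)
  ultimately show ?thesis
    by blast
qed

text \<open>The first-order condition at a minimum, in the form that the variation of the Rayleigh
  quotient needs.\<close>

lemma nonneg_quadratic_imp_linear_coeff_0:
  fixes a b :: real
  assumes "\<And>t. 0 \<le> b * t + a * t\<^sup>2"
  shows "b = 0"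
proof (rule ccontr)
  assume b: "b \<noteq> 0"
  \<comment> \<open>The nonzero root of \<open>b * t + (\<bar>a\<bar> + 1) * t\<^sup>2\<close>, a
    quadratic that lies strictly above the given one away from 0.\<close>
  define t where "t = - b / (\<bar>a\<bar> + 1)"
  have "t \<noteq> 0"
    using b by (simp add: t_def)
  then have "b * t + a * t\<^sup>2 < b * t + (\<bar>a\<bar> + 1) * t\<^sup>2"
    by (intro add_strict_left_mono mult_strict_right_mono) auto
  also have "\<dots> = 0"
  proof -
    have "(\<bar>a\<bar> + 1) * t = - b"
      by (simp add: t_def)
    then have "(\<bar>a\<bar> + 1) * t\<^sup>2 = - b * t"
      by (simp add: power2_eq_square flip: mult.assoc)
    then show ?thesis
      by simp
  qed
  finally show False
    using assms [of t] by simp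
qed

text \<open>A maximiser of the Rayleigh quotient on an invariant subspace is an eigenvector.\<close>

lemma hermitian_eigenvector_in_subspace:
  fixes A :: "complex^'d^'d"
  assumes A: "hermitian A" and W: "closed W" "\<And>x y. x \<in> W \<Longrightarrow> y \<in> W \<Longrightarrow> x + y \<in> W"
    "\<And>c x. x \<in> W \<Longrightarrow> c *s x \<in> W" "\<And>x. x \<in> W \<Longrightarrow> A *v x \<in> W"
    and x0: "x0 \<in> W" "x0 \<noteq> 0"
  shows "\<exists>x \<mu>. x \<in> W \<and> norm x = 1 \<and> A *v x = of_real \<mu> *s x"
proof -
  have WR: "t *\<^sub>R x \<in> W" if "x \<in> W" for t x
    using W(3) that by (simp add: scaleR_eq_scale)
  have Wd: "x - y \<in> W" if "x \<in> W" "y \<in> W" for x y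
    using W(2) [OF that(1) WR [OF that(2), of "-1"]] by simp
  have lin: "A *v (t *\<^sub>R x) = t *\<^sub>R (A *v x)" for t x
    by (simp add: scaleR_eq_scale vector_scalar_commute)
  have "linear ((*v) A)"
    by (intro linearI) (simp_all add: lin matrix_vector_right_distrib)
  then have cont: "continuous_on S ((*v) A)" for S
    by (rule linear_continuous_on [OF linear_conv_bounded_linear [THEN iffD1]])
  have "compact (sphere 0 1 \<inter> W)"
    using W(1) by (intro compact_Int_closed) simp_all
  moreover have "(1 / norm x0) *\<^sub>R x0 \<in> sphere 0 1 \<inter> W"
    using x0(2) WR [OF x0(1)] by simp
  then have "sphere 0 1 \<inter> W \<noteq> {}"
    by blast
  moreover have "continuous_on (sphere 0 1 \<inter> W) (\<lambda>x. x \<bullet> (A *v x))"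
    by (intro continuous_intros cont)
  ultimately obtain x where "x \<in> sphere 0 1 \<inter> W"
    and "\<forall>y\<in>sphere 0 1 \<inter> W. y \<bullet> (A *v y) \<le> x \<bullet> (A *v x)"
    using continuous_attains_sup [of "sphere 0 1 \<inter> W" "\<lambda>x. x \<bullet> (A *v x)"] by blast
  then have x: "x \<in> W" "norm x = 1"
    and max: "\<And>y. y \<in> W \<Longrightarrow> norm y = 1 \<Longrightarrow> y \<bullet> (A *v y) \<le> x \<bullet> (A *v x)"
    by simp_all
  define \<mu> where "\<mu> = x \<bullet> (A *v x)"
  have nonneg: "0 \<le> \<mu> * (y \<bullet> y) - y \<bullet> (A *v y)" if "y \<in> W" for y
  proof (cases "y = 0")
    case False
    have "((1 / norm y) *\<^sub>R y) \<bullet> (A *v ((1 / norm y) *\<^sub>R y)) \<le> \<mu>"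
      unfolding \<mu>_def using that False by (intro max WR) simp_all
    then have "(y \<bullet> (A *v y)) / (norm y)\<^sup>2 \<le> \<mu>"
      by (simp add: lin power2_eq_square)
    then show ?thesis
      using False by (simp add: divide_le_eq power2_norm_eq_inner)
  qed simp
  \<comment> \<open>The residual is used as the direction of variation: at
    \<open>x + t *\<^sub>R z\<close> the linear coefficient is twice
    \<open>z \<bullet> (\<mu> *\<^sub>R x - A *v x)\<close>, that is,
    \<open>2 * (z \<bullet> z)\<close>. Its vanishing is the eigenvalue equation.\<close>
  define z where "z = \<mu> *\<^sub>R x - A *v x"
  have z: "z \<in> W"
    unfolding z_def using x W(4) WR Wd by blast
  have sym: "x \<bullet> (A *v z) = z \<bullet> (A *v x)"
    by (metis A Re_cinner cinner_hermitian inner_commute)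
  have xx: "x \<bullet> x = 1"
    using x(2) by (simp add: norm_eq_1)
  have expand: "\<mu> * ((x + t *\<^sub>R z) \<bullet> (x + t *\<^sub>R z)) - (x + t *\<^sub>R z) \<bullet> (A *v (x + t *\<^sub>R z))
      = (2 * (z \<bullet> z)) * t + (\<mu> * (z \<bullet> z) - z \<bullet> (A *v z)) * t\<^sup>2" for t
  proof -
    have zz: "z \<bullet> (A *v x) = \<mu> * (z \<bullet> x) - z \<bullet> z"
      unfolding z_def by (simp add: inner_diff_right)
    have "x \<bullet> (A *v x) = \<mu>"
      by (simp add: \<mu>_def)
    then show ?thesis
      by (simp add: matrix_vector_right_distrib lin inner_add_left inner_add_right xx sym zz
          inner_commute [of x z] power2_eq_square) (simp add: algebra_simps)
  qed
  have "2 * (z \<bullet> z) = 0"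
  proof (rule nonneg_quadratic_imp_linear_coeff_0)
    fix t
    show "0 \<le> 2 * (z \<bullet> z) * t + (\<mu> * (z \<bullet> z) - z \<bullet> (A *v z)) * t\<^sup>2"
      using nonneg [OF W(2) [OF x(1) WR [OF z, of t]]] expand [of t] by simp
  qed
  then have "A *v x = of_real \<mu> *s x"
    by (simp add: z_def scaleR_eq_scale)
  with x show ?thesis
    by blast
qed

lemma closed_orthocomplement: "closed (orthocomplement S)"
proof -
  have "orthocomplement S = (\<Inter>y\<in>S. {x. cinner x y = 0})"
    by (auto simp: orthocomplement_def)
  moreover have "closed {x. cinner x y = 0}" for y :: "complex^'d"
    unfolding cinner_def by (intro closed_Collect_eq continuous_intros)
  ultimately show ?thesis
    by auto
qed

text \<open>Induction on a set of indices: while indices remain, the orthocomplement of the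
  eigenvectors found so far is nonzero and invariant under \<open>A\<close>, so it contains another
  one. Staying in invariant subspaces of the full space keeps the dimension type fixed.\<close>

theorem hermitian_eigenbasis_exists:
  fixes A :: "complex^'d^'d"
  assumes A: "hermitian A"
  shows "\<exists>u \<alpha>. eigenbasis A u \<alpha>"
proof -
  have "\<exists>u \<alpha>. orthonormal_on K u \<and> (\<forall>k\<in>K. A *v u k = of_real (\<alpha> k) *s u k)" for K :: "'d set"
    using finite [of K]
  proof (induction K rule: finite_induct)
    case empty
    show ?case by (simp add: orthonormal_on_def)
  next
    case (insert m K)
    then obtain u \<alpha> where u: "orthonormal_on K u" "\<And>k. k \<in> K \<Longrightarrow> A *v u k = of_real (\<alpha> k) *s u k"
      by blast
    have "card K < card (UNIV :: 'd set)"
      using insert.hyps by (intro psubset_card_mono) auto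
    then obtain x0 where x0: "x0 \<noteq> 0" "x0 \<in> orthocomplement (u ` K)"
      using orthocomplement_nontrivial [of "u ` K"] insert.hyps(1) card_image_le [of K u] by force
    have inv: "A *v x \<in> orthocomplement (u ` K)" if "x \<in> orthocomplement (u ` K)" for x
      using that u(2) by (auto simp: orthocomplement_def cinner_hermitian [OF A] cinner_scale_right)
    have "\<exists>x \<mu>. x \<in> orthocomplement (u ` K) \<and> norm x = 1 \<and> A *v x = of_real \<mu> *s x"
      using x0(2,1)
      by (intro hermitian_eigenvector_in_subspace [OF A] closed_orthocomplement inv)
        (auto simp: orthocomplement_def cinner_add_left cinner_scale_left)
    then obtain x \<mu> where x: "x \<in> orthocomplement (u ` K)" "norm x = 1" "A *v x = of_real \<mu> *s x"
      by blast
    have orth: "cinner x (u k) = 0" "cinner (u k) x = 0" if "k \<in> K" for k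
      using x(1) that cinner_eq_0_commute by (auto simp: orthocomplement_def)
    have xx: "cinner x x = 1"
      using x(2) by (simp add: cinner_self)
    have neq: "k \<noteq> m" if "k \<in> K" for k
      using that insert.hyps by auto
    show ?case
    proof (intro exI conjI)
      show "orthonormal_on (insert m K) (u(m := x))"
        using u(1) orth xx neq insert.hyps(2) by (auto simp: orthonormal_on_def)
      show "\<forall>k\<in>insert m K. A *v (u(m := x)) k = of_real ((\<alpha>(m := \<mu>)) k) *s (u(m := x)) k"
        using u(2) x(3) neq by auto
    qed
  qed
  from this [of UNIV] show ?thesis
    by (auto simp: eigenbasis_def)
qed

section \<open>Expansion of vectors and quadratic forms in an orthonormal eigenbasis\<close>

definition basis_matrix :: "('d \<Rightarrow> complex^'d) \<Rightarrow> complex^'d^'d" where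
  "basis_matrix u = (\<chi> a k. u k $ a)"

lemma basis_matrix_unitary:
  assumes "orthonormal_on UNIV u"
  shows "adjoint_matrix (basis_matrix u) ** basis_matrix u = mat 1"
    and "basis_matrix u ** adjoint_matrix (basis_matrix u) = mat 1"
proof -
  have "(adjoint_matrix (basis_matrix u) ** basis_matrix u) $ k $ l = cinner (u l) (u k)" for k l
    by (simp add: adjoint_matrix_def basis_matrix_def matrix_matrix_mult_def cinner_def mult.commute)
  then show "adjoint_matrix (basis_matrix u) ** basis_matrix u = mat 1"
    using assms by (auto simp: vec_eq_iff mat_def orthonormal_on_def)
  then show "basis_matrix u ** adjoint_matrix (basis_matrix u) = mat 1"
    by (simp add: matrix_left_right_inverse)
qed

lemma eigenbasis_expansion:
  fixes u :: "'d \<Rightarrow> complex^'d"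
  assumes "orthonormal_on UNIV u"
  shows "x = (\<Sum>k\<in>UNIV. cinner x (u k) *s u k)"
proof -
  have "x = basis_matrix u *v (adjoint_matrix (basis_matrix u) *v x)"
    by (simp add: matrix_vector_mul_assoc basis_matrix_unitary [OF assms])
  also have "adjoint_matrix (basis_matrix u) *v x = (\<chi> k. cinner x (u k))"
    by (simp add: vec_eq_iff matrix_vector_mult_def adjoint_matrix_def basis_matrix_def cinner_def
        mult.commute)
  also have "basis_matrix u *v \<dots> = (\<Sum>k\<in>UNIV. cinner x (u k) *s u k)"
    by (simp add: vec_eq_iff matrix_vector_mult_def basis_matrix_def mult.commute)
  finally show ?thesis .
qed

lemma parseval:
  fixes u :: "'d \<Rightarrow> complex^'d"
  assumes "orthonormal_on UNIV u"
  shows "(norm x)\<^sup>2 = (\<Sum>k\<in>UNIV. (cmod (cinner x (u k)))\<^sup>2)"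
proof -
  have "cinner x x = cinner (\<Sum>k\<in>UNIV. cinner x (u k) *s u k) x"
    by (rule arg_cong [where f = "\<lambda>y. cinner y x", OF eigenbasis_expansion [OF assms]])
  also have "\<dots> = (\<Sum>k\<in>UNIV. cinner x (u k) * cinner (u k) x)"
    by (simp only: cinner_sum_left cinner_scale_left)
  also have "\<dots> = (\<Sum>k\<in>UNIV. of_real ((cmod (cinner x (u k)))\<^sup>2))"
    unfolding complex_norm_square
    by (intro sum.cong refl arg_cong2 [where f = "(*)"] cinner_commute)
  finally have "complex_of_real ((norm x)\<^sup>2) = of_real (\<Sum>k\<in>UNIV. (cmod (cinner x (u k)))\<^sup>2)"
    by (simp add: cinner_self)
  then show ?thesis
    by (simp only: of_real_eq_iff)
qed

lemma inner_eigenbasis: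
  assumes "eigenbasis A u \<alpha>"
  shows "x \<bullet> (A *v x) = (\<Sum>k\<in>UNIV. \<alpha> k * (cmod (cinner x (u k)))\<^sup>2)"
proof -
  have o: "orthonormal_on UNIV u" and e: "\<And>k. A *v u k = of_real (\<alpha> k) *s u k"
    using assms by (auto simp: eigenbasis_def)
  have "A *v x = A *v (\<Sum>k\<in>UNIV. cinner x (u k) *s u k)"
    by (rule arg_cong [OF eigenbasis_expansion [OF o]])
  also have "\<dots> = (\<Sum>k\<in>UNIV. (of_real (\<alpha> k) * cinner x (u k)) *s u k)"
    by (simp add: vec.linear_sum e vec.linear_scale mult.commute
        vec.sum vec.scale)
  finally have "cinner (A *v x) x = (\<Sum>k\<in>UNIV. of_real (\<alpha> k) * (cinner x (u k) * cinner (u k) x))"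
    by (simp only: cinner_sum_left cinner_scale_left mult.assoc)
  also have "\<dots> = (\<Sum>k\<in>UNIV. of_real (\<alpha> k) * of_real ((cmod (cinner x (u k)))\<^sup>2))"
    unfolding complex_norm_square
    by (intro sum.cong refl arg_cong2 [where f = "(*)"] cinner_commute)
  also have "\<dots> = of_real (\<Sum>k\<in>UNIV. \<alpha> k * (cmod (cinner x (u k)))\<^sup>2)"
    by simp
  finally have "Re (cinner (A *v x) x) = (\<Sum>k\<in>UNIV. \<alpha> k * (cmod (cinner x (u k)))\<^sup>2)"
    by (simp only: Re_complex_of_real)
  then show ?thesis
    by (simp only: Re_cinner inner_commute)
qed

section \<open>Ordered eigenvalues\<close>

text \<open>Polynomials over the complex numbers are determined by their values. At each
  \<open>x\<close> the value is \<open>det (mat x - A)\<close>, and the basis matrix, whose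
  determinant is nonzero, intertwines \<open>mat x - A\<close> with a diagonal matrix.\<close>

lemma charpoly_eigenbasis:
  fixes A :: "complex^'d^'d"
  assumes "eigenbasis A u \<alpha>"
  shows "charpoly A = (\<Prod>k\<in>UNIV. [: - of_real (\<alpha> k), 1 :])"
proof -
  have o: "orthonormal_on UNIV u" and e: "\<And>k. A *v u k = of_real (\<alpha> k) *s u k"
    using assms by (auto simp: eigenbasis_def)
  have "poly (charpoly A) x = (\<Prod>k\<in>UNIV. x - of_real (\<alpha> k))" for x
  proof -
    define D :: "complex^'d^'d" where "D = (\<chi> k l. if k = l then x - of_real (\<alpha> k) else 0)"
    have "poly (charpoly A) x = det (mat x - A)"
      unfolding charpoly_def det_def poly_sum poly_mult poly_prod poly_of_int
      by (intro sum.cong refl arg_cong2 [where f = "(*)"] prod.cong) (simp add: mat_def)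
    moreover have "(mat x - A) ** basis_matrix u = basis_matrix u ** D"
    proof -
      have A: "(\<Sum>b\<in>UNIV. u k $ b * A $ a $ b) = of_real (\<alpha> k) * u k $ a" for a k
        using arg_cong [OF e [of k], of "\<lambda>y. y $ a"]
        by (simp add: matrix_vector_mult_def mult.commute)
      show ?thesis
        by (simp add: vec_eq_iff matrix_matrix_mult_def basis_matrix_def D_def mat_def
            left_diff_distrib sum_subtractf A if_distrib [of "\<lambda>y. y * _"] if_distrib [of "\<lambda>y. _ * y"]
            algebra_simps cong: if_cong)
    qed
    then have "det (mat x - A) * det (basis_matrix u) = det (basis_matrix u) * det D"
      by (metis det_mul)
    moreover have "det (basis_matrix u) \<noteq> 0"
      using basis_matrix_unitary(1) [OF o] by (metis det_I det_mul mult_zero_right zero_neq_one)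
    moreover have "det D = (\<Prod>k\<in>UNIV. x - of_real (\<alpha> k))"
      by (subst det_diagonal) (simp_all add: D_def)
    ultimately show ?thesis
      by simp
  qed
  then show ?thesis
    by (intro poly_eq_poly_eq_iff [THEN iffD1] ext) (simp add: poly_prod)
qed

lemma proots_charpoly_eigenbasis:
  assumes "eigenbasis A u \<alpha>"
  shows "proots (charpoly A) = image_mset (\<lambda>k. of_real (\<alpha> k)) (mset_set UNIV)"
proof -
  have "proots (charpoly A) = (\<Sum>k\<in>UNIV. {#of_real (\<alpha> k)#})"
    unfolding charpoly_eigenbasis [OF assms] by (subst proots_prod) simp_all
  then show ?thesis
    by (simp add: sum_unfold_sum_mset)
qed

text \<open>In a decreasing list the positions with entries at least \<open>c\<close> form an
  initial segment, so position \<open>j - 1\<close>, counted from 0, lies in it iff it has at least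
  \<open>j\<close> elements. Comparing ordered eigenvalues thereby becomes comparing
  cardinalities.\<close>

lemma nth_rev_sorted_ge_iff:
  fixes M :: "real multiset"
  assumes "1 \<le> j" "j \<le> size M"
  shows "c \<le> rev (sorted_list_of_multiset M) ! (j - 1) \<longleftrightarrow> j \<le> size (filter_mset (\<lambda>x. c \<le> x) M)"
proof -
  define xs where "xs = rev (sorted_list_of_multiset M)"
  have M: "mset xs = M"
    by (simp add: xs_def)
  have len: "length xs = size M"
    by (metis M size_mset)
  define I where "I = {l. l < length xs \<and> c \<le> xs ! l}"
  have "size (filter_mset (\<lambda>x. c \<le> x) M) = card I"
    by (metis I_def M length_filter_conv_card mset_filter size_mset)
  moreover have anti: "xs ! l' \<le> xs ! l" if "l \<le> l'" "l' < length xs" for l l'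
    using that sorted_rev_nth_mono [of xs l l'] by (simp add: xs_def)
  have "c \<le> xs ! (j - 1) \<longleftrightarrow> j \<le> card I"
  proof
    assume c: "c \<le> xs ! (j - 1)"
    have "{..<j} \<subseteq> I"
      using assms c by (auto simp: I_def len intro: order_trans [OF c anti])
    then have "card {..<j} \<le> card I"
      by (intro card_mono) (simp_all add: I_def)
    then show "j \<le> card I"
      by simp
  next
    assume j: "j \<le> card I"
    show "c \<le> xs ! (j - 1)"
    proof (rule ccontr)
      assume c: "\<not> c \<le> xs ! (j - 1)"
      have "l < j - 1" if "l \<in> I" for l
        using that c anti [of "j - 1" l] by (force simp: I_def not_less)
      then have "I \<subseteq> {..<j - 1}"
        by auto
      then have "card I \<le> card {..<j - 1}"
        by (intro card_mono) simp_all
      then show False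
        using j assms(1) by simp
    qed
  qed
  ultimately show ?thesis
    by (simp add: xs_def)
qed

lemma ordered_eigenvalue_eigenbasis:
  assumes "eigenbasis A u \<alpha>"
  shows "ordered_eigenvalue A j =
    rev (sorted_list_of_multiset (image_mset \<alpha> (mset_set UNIV))) ! (j - 1)"
  by (simp add: ordered_eigenvalue_def proots_charpoly_eigenbasis [OF assms] multiset.map_comp o_def)

lemma ordered_eigenvalue_ge_iff:
  fixes A :: "complex^'d^'d"
  assumes "eigenbasis A u \<alpha>" "1 \<le> j" "j \<le> CARD('d)"
  shows "c \<le> ordered_eigenvalue A j \<longleftrightarrow> j \<le> card {k. c \<le> \<alpha> k}"
proof -
  have "size (filter_mset (\<lambda>x. c \<le> x) (image_mset \<alpha> (mset_set UNIV))) = card {k. c \<le> \<alpha> k}"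
    by (simp add: filter_mset_image_mset filter_mset_mset_set)
  then show ?thesis
    unfolding ordered_eigenvalue_eigenbasis [OF assms(1)]
    using assms(2,3) by (subst nth_rev_sorted_ge_iff) simp_all
qed

lemma ordered_eigenvalue_is_eigenvalue:
  fixes A :: "complex^'d^'d"
  assumes "eigenbasis A u \<alpha>" "1 \<le> j" "j \<le> CARD('d)"
  shows "\<exists>k. ordered_eigenvalue A j = \<alpha> k"
proof -
  let ?xs = "rev (sorted_list_of_multiset (image_mset \<alpha> (mset_set UNIV)))"
  have "length ?xs = CARD('d)"
    by (metis card_eq_sum length_rev mset_sorted_list_of_multiset size_image_mset size_mset size_mset_set)
  then have "?xs ! (j - 1) \<in> set ?xs"
    using assms(2,3) by (intro nth_mem) simp
  then show ?thesis
    by (auto simp: ordered_eigenvalue_eigenbasis [OF assms(1)])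
qed

lemma simple_eigenvalue_eigenbasis:
  assumes "eigenbasis A u \<alpha>"
  shows "simple_eigenvalue A (of_real x) \<longleftrightarrow> (\<exists>!k. \<alpha> k = x)"
proof -
  have "count (proots (charpoly A)) (of_real x) = card {k. \<alpha> k = x}"
    by (simp add: proots_charpoly_eigenbasis [OF assms] count_image_mset vimage_def Collect_conj_eq)
  moreover have "(\<exists>a. {k. \<alpha> k = x} = {a}) \<longleftrightarrow> (\<exists>!k. \<alpha> k = x)"
  proof
    assume "\<exists>a. {k. \<alpha> k = x} = {a}"
    then obtain a where "\<And>k. \<alpha> k = x \<longleftrightarrow> k = a"
      by (auto simp: set_eq_iff)
    then show "\<exists>!k. \<alpha> k = x"
      by simp
  next
    assume "\<exists>!k. \<alpha> k = x"
    then show "\<exists>a. {k. \<alpha> k = x} = {a}"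
      by (auto simp: set_eq_iff)
  qed
  ultimately show ?thesis
    by (simp only: simple_eigenvalue_def card_1_singleton_iff One_nat_def)
qed

text \<open>A vector orthogonal to the eigenvectors of \<open>A\<close> below \<open>c\<close> and to those of \<open>B\<close> not below
  \<open>c - \<epsilon>\<close> vanishes, so there are at least \<open>CARD('d)\<close> of them.\<close>

lemma card_eigenvalues_ge_perturb:
  fixes A B :: "complex^'d^'d"
  assumes A: "eigenbasis A u \<alpha>" and B: "eigenbasis B v \<beta>"
    and le: "\<And>x. x \<bullet> (A *v x) - \<epsilon> * (norm x)\<^sup>2 \<le> x \<bullet> (B *v x)"
  shows "card {k. c \<le> \<alpha> k} \<le> card {k. c - \<epsilon> \<le> \<beta> k}"
proof (rule ccontr)
  assume less: "\<not> ?thesis"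
  have ou: "orthonormal_on UNIV u" and ov: "orthonormal_on UNIV v"
    using A B by (auto simp: eigenbasis_def)
  define F where "F = u ` {k. \<not> c \<le> \<alpha> k} \<union> v ` {k. c - \<epsilon> \<le> \<beta> k}"
  have "card F \<le> card {k. \<not> c \<le> \<alpha> k} + card {k. c - \<epsilon> \<le> \<beta> k}"
    unfolding F_def by (intro order_trans [OF card_Un_le] add_mono card_image_le) simp_all
  also have "\<dots> < card {k. \<not> c \<le> \<alpha> k} + card {k. c \<le> \<alpha> k}"
    using less by simp
  also have "\<dots> = card ({k. \<not> c \<le> \<alpha> k} \<union> {k. c \<le> \<alpha> k})"
    by (intro card_Un_disjoint [symmetric]) auto
  also have "{k. \<not> c \<le> \<alpha> k} \<union> {k. c \<le> \<alpha> k} = UNIV"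
    by auto
  finally obtain x where x: "x \<noteq> 0" "x \<in> orthocomplement F"
    using orthocomplement_nontrivial [of F] by (auto simp: F_def)
  have "c * (norm x)\<^sup>2 \<le> x \<bullet> (A *v x)"
    unfolding inner_eigenbasis [OF A] parseval [OF ou] sum_distrib_left
  proof (rule sum_mono)
    fix k
    show "c * (cmod (cinner x (u k)))\<^sup>2 \<le> \<alpha> k * (cmod (cinner x (u k)))\<^sup>2"
      using x(2) by (cases "c \<le> \<alpha> k") (auto simp: orthocomplement_def F_def intro: mult_right_mono)
  qed
  \<comment> \<open>Only eigenvectors of \<open>B\<close> with eigenvalue below
    \<open>c - \<epsilon>\<close> contribute to \<open>x\<close>, and at least one does because
    \<open>x\<close> is nonzero. This gives the strict inequality on which the contradiction
    rests.\<close>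
  moreover have "x \<bullet> (B *v x) < (c - \<epsilon>) * (norm x)\<^sup>2"
  proof -
    have "\<exists>k. cinner x (v k) \<noteq> 0"
      using x(1) parseval [OF ov, of x] by (auto intro: ccontr)
    then obtain k0 where k0: "cinner x (v k0) \<noteq> 0"
      by blast
    have "0 < (\<Sum>k\<in>UNIV. (c - \<epsilon> - \<beta> k) * (cmod (cinner x (v k)))\<^sup>2)"
    proof (rule sum_pos2 [where i = k0])
      have "\<not> c - \<epsilon> \<le> \<beta> k0"
        using k0 x(2) by (auto simp: orthocomplement_def F_def)
      then show "0 < (c - \<epsilon> - \<beta> k0) * (cmod (cinner x (v k0)))\<^sup>2"
        using k0 by simp
      show "0 \<le> (c - \<epsilon> - \<beta> k) * (cmod (cinner x (v k)))\<^sup>2" for k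
        using x(2) by (cases "c - \<epsilon> \<le> \<beta> k") (auto simp: orthocomplement_def F_def)
    qed auto
    then show ?thesis
      unfolding inner_eigenbasis [OF B] parseval [OF ov] sum_distrib_left
      by (simp add: left_diff_distrib sum_subtractf)
  qed
  ultimately show False
    using le [of x] by (simp add: left_diff_distrib)
qed

text \<open>Weyl's inequality: the two quadratic forms differ by at most \<open>\<epsilon>\<close>
  times the squared norm, so the counting comparison applies in both directions.\<close>

lemma ordered_eigenvalue_lipschitz:
  fixes A B :: "complex^'d^'d"
  assumes "hermitian A" "hermitian B" "1 \<le> j" "j \<le> CARD('d)"
  shows "\<bar>ordered_eigenvalue A j - ordered_eigenvalue B j\<bar> \<le> real CARD('d) * norm (A - B)"
proof -
  define \<epsilon> where "\<epsilon> = real CARD('d) * norm (A - B)"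
  have bound: "\<bar>x \<bullet> (A *v x) - x \<bullet> (B *v x)\<bar> \<le> \<epsilon> * (norm x)\<^sup>2" for x
  proof -
    have "\<bar>x \<bullet> (A *v x) - x \<bullet> (B *v x)\<bar> = \<bar>x \<bullet> ((A - B) *v x)\<bar>"
      by (simp add: matrix_vector_mult_diff_rdistrib inner_diff_right)
    also have "\<dots> \<le> norm x * norm ((A - B) *v x)"
      by (rule Cauchy_Schwarz_ineq2)
    also have "\<dots> \<le> norm x * (real CARD('d) * norm (A - B) * norm x)"
      by (intro mult_left_mono norm_matrix_vector_le) simp
    finally show ?thesis
      by (simp add: \<epsilon>_def power2_eq_square mult_ac)
  qed
  obtain u \<alpha> v \<beta> where A: "eigenbasis A u \<alpha>" and B: "eigenbasis B v \<beta>"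
    using assms(1,2) hermitian_eigenbasis_exists by meson
  have "card {k. c \<le> \<alpha> k} \<le> card {k. c - \<epsilon> \<le> \<beta> k}" for c
  proof (rule card_eigenvalues_ge_perturb [OF A B])
    show "x \<bullet> (A *v x) - \<epsilon> * (norm x)\<^sup>2 \<le> x \<bullet> (B *v x)" for x
      using bound [of x] by linarith
  qed
  moreover have "card {k. c \<le> \<beta> k} \<le> card {k. c - \<epsilon> \<le> \<alpha> k}" for c
  proof (rule card_eigenvalues_ge_perturb [OF B A])
    show "x \<bullet> (B *v x) - \<epsilon> * (norm x)\<^sup>2 \<le> x \<bullet> (A *v x)" for x
      using bound [of x] by linarith
  qed
  \<comment> \<open>Each count comparison is used with \<open>c\<close> equal to the ordered
    eigenvalue itself, for which the count is at least \<open>j\<close>.\<close>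
  ultimately have "ordered_eigenvalue A j - \<epsilon> \<le> ordered_eigenvalue B j"
    "ordered_eigenvalue B j - \<epsilon> \<le> ordered_eigenvalue A j"
    using ordered_eigenvalue_ge_iff [OF A assms(3,4)] ordered_eigenvalue_ge_iff [OF B assms(3,4)]
    by (meson order_refl order_trans)+
  then show ?thesis
    by (simp add: \<epsilon>_def)
qed

section \<open>Perturbation of a simple eigenvalue\<close>

text \<open>In an eigenbasis \<open>A - \<mu>\<close> multiplies the coefficients by
  \<open>\<alpha> k - \<mu>\<close>. Simplicity leaves one zero factor, at \<open>k0\<close>, and
  makes \<open>w\<close> a multiple of \<open>u k0\<close>; orthogonality to \<open>w\<close>
  removes exactly that coefficient.\<close>

lemma spectral_gap:
  fixes A :: "complex^'d^'d"
  assumes A: "hermitian A" and simple: "simple_eigenvalue A (of_real \<mu>)"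
    and w: "w \<noteq> 0" "A *v w = of_real \<mu> *s w"
  shows "\<exists>g>0. \<forall>x. cinner x w = 0 \<longrightarrow> g * norm x \<le> norm (A *v x - of_real \<mu> *s x)"
proof -
  obtain u \<alpha> where u: "eigenbasis A u \<alpha>"
    using hermitian_eigenbasis_exists [OF A] by blast
  then have o: "orthonormal_on UNIV u" and e: "\<And>k. A *v u k = of_real (\<alpha> k) *s u k"
    by (auto simp: eigenbasis_def)
  obtain k0 where k0: "\<alpha> k0 = \<mu>" "\<And>k. \<alpha> k = \<mu> \<Longrightarrow> k = k0"
    using simple unfolding simple_eigenvalue_eigenbasis [OF u] by blast
  have coeff: "cinner (A *v x - of_real \<mu> *s x) (u k) = of_real (\<alpha> k - \<mu>) * cinner x (u k)" for x k
    by (simp add: cinner_diff_left cinner_hermitian [OF A] e cinner_scale_left cinner_scale_right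
        left_diff_distrib)
  have w_coeff: "cinner w (u k) = 0" if "k \<noteq> k0" for k
    using coeff [of w k] w(2) k0(2) that by auto
  have "w = (\<Sum>k\<in>UNIV. cinner w (u k) *s u k)"
    by (rule eigenbasis_expansion [OF o])
  also have "\<dots> = (\<Sum>k\<in>UNIV. if k = k0 then cinner w (u k) *s u k else 0)"
    by (intro sum.cong) (auto simp: w_coeff)
  finally have w_eq: "w = cinner w (u k0) *s u k0"
    by simp
  then have "cinner w (u k0) \<noteq> 0"
    using w(1) by (metis vec.scale_zero_left)
  then have orth: "cinner x (u k0) = 0" if "cinner x w = 0" for x
    using that by (subst (asm) w_eq) (simp add: cinner_scale_right)
  \<comment> \<open>The distance from \<open>\<mu>\<close> to the rest of the spectrum, capped at 1;
    the inserted 1 keeps \<open>Min\<close> meaningful when \<open>k0\<close> is the only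
    index.\<close>
  define g where "g = Min (insert 1 ((\<lambda>k. \<bar>\<alpha> k - \<mu>\<bar>) ` {k. k \<noteq> k0}))"
  have g: "0 < g" "\<And>k. k \<noteq> k0 \<Longrightarrow> g \<le> \<bar>\<alpha> k - \<mu>\<bar>"
    using k0(2) by (auto simp: g_def)
  have "g * norm x \<le> norm (A *v x - of_real \<mu> *s x)" if x: "cinner x w = 0" for x
  proof -
    have "(g * norm x)\<^sup>2 \<le> (norm (A *v x - of_real \<mu> *s x))\<^sup>2"
      unfolding power_mult_distrib parseval [OF o] sum_distrib_left coeff norm_mult norm_of_real
    proof (rule sum_mono)
      fix k
      show "g\<^sup>2 * (cmod (cinner x (u k)))\<^sup>2 \<le> \<bar>\<alpha> k - \<mu>\<bar>\<^sup>2 * (cmod (cinner x (u k)))\<^sup>2"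
      proof (cases "k = k0")
        case False
        then show ?thesis
          using g by (intro mult_right_mono power_mono) auto
      qed (simp add: orth [OF x])
    qed
    then show ?thesis
      by (rule power2_le_imp_le) simp
  qed
  with g(1) show ?thesis
    by blast
qed

lemma ordered_eigenvalue_eigenvector:
  fixes A :: "complex^'d^'d"
  assumes "hermitian A" "1 \<le> j" "j \<le> CARD('d)"
  shows "\<exists>w. norm w = 1 \<and> A *v w = of_real (ordered_eigenvalue A j) *s w"
proof -
  obtain u \<alpha> where u: "eigenbasis A u \<alpha>"
    using hermitian_eigenbasis_exists [OF assms(1)] by blast
  then obtain k where k: "ordered_eigenvalue A j = \<alpha> k"
    using ordered_eigenvalue_is_eigenvalue assms(2,3) by blast
  have "cinner (u k) (u k) = 1" "A *v u k = of_real (\<alpha> k) *s u k"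
    using u by (auto simp: eigenbasis_def orthonormal_on_def)
  moreover from this(1) have "norm (u k) = 1"
    by (simp add: cinner_self power2_eq_1_iff flip: of_real_power) (metis norm_ge_zero one_neq_neg_one neg_0_le_iff_le not_one_le_zero)
  ultimately show ?thesis
    using k by metis
qed

text \<open>Two independent eigenvectors of \<open>B\<close> for one eigenvalue would have a nonzero
  combination orthogonal to \<open>w\<close>. For \<open>B\<close> near \<open>A\<close> this is
  almost an eigenvector of \<open>A\<close> for \<open>\<mu>\<close>, against the spectral
  gap.\<close>

lemma simple_eigenvalue_open:
  fixes A :: "complex^'d^'d"
  assumes A: "hermitian A" and j: "1 \<le> j" "j \<le> CARD('d)"
    and simple: "simple_eigenvalue A (of_real (ordered_eigenvalue A j))"
  shows "\<exists>\<epsilon>>0. \<forall>B. hermitian B \<longrightarrow> norm (A - B) < \<epsilon> \<longrightarrow>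
    simple_eigenvalue B (of_real (ordered_eigenvalue B j))"
proof -
  define \<mu> where "\<mu> = ordered_eigenvalue A j"
  obtain w where "norm w = 1" and w: "A *v w = of_real \<mu> *s w"
    using ordered_eigenvalue_eigenvector [OF A j] by (auto simp: \<mu>_def)
  then have "w \<noteq> 0"
    by auto
  then obtain g where g: "0 < g"
    and gap: "\<And>x. cinner x w = 0 \<Longrightarrow> g * norm x \<le> norm (A *v x - of_real \<mu> *s x)"
    using spectral_gap [OF A simple [folded \<mu>_def] _ w] by blast
  \<comment> \<open>The threshold gives \<open>2 * \<eta> < g\<close>: the perturbation enters
    twice, through \<open>A - B\<close> applied to a vector and through the shift of the eigenvalue,
    each time with size at most \<open>\<eta>\<close>.\<close>
  have "simple_eigenvalue B (of_real (ordered_eigenvalue B j))"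
    if B: "hermitian B" and near: "norm (A - B) < g / (2 * real CARD('d))" for B
  proof -
    define \<nu> where "\<nu> = ordered_eigenvalue B j"
    define \<eta> where "\<eta> = real CARD('d) * norm (A - B)"
    have \<eta>: "2 * \<eta> < g"
      using near by (simp add: \<eta>_def field_simps)
    have \<mu>\<nu>: "\<bar>\<nu> - \<mu>\<bar> \<le> \<eta>"
      using ordered_eigenvalue_lipschitz [OF A B j] by (simp add: \<mu>_def \<nu>_def \<eta>_def)
    have no_vec: "x = 0" if x: "B *v x = of_real \<nu> *s x" "cinner x w = 0" for x
    proof (rule ccontr)
      assume "x \<noteq> 0"
      have "A *v x - of_real \<mu> *s x = (A - B) *v x + of_real (\<nu> - \<mu>) *s x"
        using x(1) by (simp add: matrix_vector_mult_diff_rdistrib vec.scale_left_diff_distrib)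
      then have "norm (A *v x - of_real \<mu> *s x) \<le> norm ((A - B) *v x) + norm (of_real (\<nu> - \<mu>) *s x)"
        by (simp only: norm_triangle_ineq)
      also have "\<dots> \<le> \<eta> * norm x + \<eta> * norm x"
        unfolding norm_scale norm_of_real \<eta>_def using \<mu>\<nu>
        by (intro add_mono norm_matrix_vector_le mult_right_mono) (simp_all add: \<eta>_def)
      finally have "g * norm x \<le> (2 * \<eta>) * norm x"
        using gap [OF x(2)] by simp
      then show False
        using \<eta> \<open>x \<noteq> 0\<close> by simp
    qed
    obtain v \<beta> where v: "eigenbasis B v \<beta>"
      using hermitian_eigenbasis_exists [OF B] by blast
    then have o: "cinner (v k) (v l) = (if k = l then 1 else 0)"
      and e: "B *v v k = of_real (\<beta> k) *s v k" for k l
      by (auto simp: eigenbasis_def orthonormal_on_def)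
    have "k = l" if "\<beta> k = \<nu>" "\<beta> l = \<nu>" for k l
    proof (rule ccontr)
      assume "k \<noteq> l"
      \<comment> \<open>The coefficients make \<open>x\<close> orthogonal to \<open>w\<close>, so
        \<open>x = 0\<close>. Pairing \<open>x\<close> with \<open>v k\<close> then shows that
        \<open>v l\<close> is itself orthogonal to \<open>w\<close>, hence also zero.\<close>
      define x where "x = cinner (v l) w *s v k - cinner (v k) w *s v l"
      have "x = 0"
        by (rule no_vec) (simp_all add: x_def matrix_vector_mult_diff_distrib vector_scalar_commute
            e that cinner_diff_left cinner_scale_left vec.scale_right_diff_distrib mult.commute)
      moreover have "cinner x (v k) = cinner (v l) w"
        using \<open>k \<noteq> l\<close> by (simp add: x_def cinner_diff_left cinner_scale_left o)
      ultimately have "v l = 0"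
        using e that(2) by (intro no_vec) simp_all
      then show False
        using o [of l l] by simp
    qed
    moreover have "\<exists>k. \<beta> k = \<nu>"
      using ordered_eigenvalue_is_eigenvalue [OF v j] by (auto simp: \<nu>_def)
    ultimately show ?thesis
      unfolding simple_eigenvalue_eigenbasis [OF v] \<nu>_def by blast
  qed
  moreover have "0 < g / (2 * real CARD('d))"
    using g by simp
  ultimately show ?thesis
    by blast
qed

lemma has_real_derivative_0_quadratic:
  fixes f :: "real \<Rightarrow> real"
  assumes "0 < \<delta>" "\<And>t. \<bar>t\<bar> < \<delta> \<Longrightarrow> \<bar>f t - f 0 - D * t\<bar> \<le> K * t\<^sup>2"
  shows "(f has_real_derivative D) (at 0)"
proof -
  have "((\<lambda>t. (f t - f 0) / t - D) \<longlongrightarrow> 0) (at 0)"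
  proof (rule Lim_null_comparison)
    have "\<forall>\<^sub>F t in at 0. \<bar>t\<bar> < \<delta> \<and> t \<noteq> (0::real)"
      using assms(1) by (auto simp: eventually_at dist_real_def)
    then show "\<forall>\<^sub>F t in at 0. norm ((f t - f 0) / t - D) \<le> K * \<bar>t\<bar>"
    proof eventually_elim
      case (elim t)
      then have "\<bar>(f t - f 0) / t - D\<bar> * \<bar>t\<bar> = \<bar>f t - f 0 - D * t\<bar>"
        by (subst abs_mult [symmetric], subst left_diff_distrib) simp
      also have "\<dots> \<le> (K * \<bar>t\<bar>) * \<bar>t\<bar>"
        using assms(2) [of t] elim by (simp add: power2_eq_square)
      finally show ?case
        using elim by simp
    qed
    show "((\<lambda>t. K * \<bar>t\<bar>) \<longlongrightarrow> 0) (at 0)"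
      by (rule tendsto_eq_intros refl | simp)+
  qed
  then show ?thesis
    by (simp add: DERIV_def LIM_zero_iff)
qed

text \<open>If \<open>v\<close> is a unit eigenvector of \<open>A + t Y\<close> for the perturbed eigenvalue, the spectral gap bounds
  the component \<open>x\<close> of \<open>v\<close> orthogonal to \<open>w\<close> by a multiple of \<open>t\<close>, so pairing the eigenvector equation
  with \<open>w\<close> determines the eigenvalue up to \<open>O(t\<^sup>2)\<close>.\<close>

lemma ordered_eigenvalue_derivative:
  fixes A :: "complex^'d^'d"
  assumes A: "hermitian A" and Y: "hermitian Y" and j: "1 \<le> j" "j \<le> CARD('d)"
    and simple: "simple_eigenvalue A (of_real (ordered_eigenvalue A j))"
    and w1: "norm w = 1" and w: "A *v w = of_real (ordered_eigenvalue A j) *s w"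
  shows "((\<lambda>t. ordered_eigenvalue (A + t *\<^sub>R Y) j) has_real_derivative w \<bullet> (Y *v w)) (at 0)"
proof -
  define \<mu> where "\<mu> = ordered_eigenvalue A j"
  define L where "L = real CARD('d) * norm Y"
  have L: "0 \<le> L" "\<And>x. norm (Y *v x) \<le> L * norm x"
    using norm_matrix_vector_le by (auto simp: L_def)
  have "w \<noteq> 0"
    using w1 by auto
  then obtain g where g: "0 < g"
    and gap: "\<And>x. cinner x w = 0 \<Longrightarrow> g * norm x \<le> norm (A *v x - of_real \<mu> *s x)"
    using spectral_gap [OF A simple _ w] by (auto simp: \<mu>_def)
  define D where "D = w \<bullet> (Y *v w)"
  have D: "cinner (Y *v w) w = of_real D"
  proof (rule complex_eqI)
    have "cinner (Y *v w) w = cnj (cinner (Y *v w) w)"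
      using cinner_commute [of "Y *v w" w] cinner_hermitian [OF Y, of w w] by simp
    then show "Im (cinner (Y *v w) w) = Im (of_real D)"
      by (simp add: complex_eq_iff)
  qed (simp add: D_def Re_cinner inner_commute)
  \<comment> \<open>The \<open>4 * L\<close> in the radius makes the component of \<open>v\<close>
    along \<open>w\<close> at least 1/2 in modulus; the \<open>+ 1\<close> covers
    \<open>Y = 0\<close>. In the remainder, \<open>2 * L\<^sup>2 / g\<close> comes from the gap
    estimate for \<open>x\<close>, and dividing by that component doubles it.\<close>
  have bound: "\<bar>ordered_eigenvalue (A + t *\<^sub>R Y) j - \<mu> - D * t\<bar> \<le> (4 * L\<^sup>2 / g) * t\<^sup>2"
    if t: "\<bar>t\<bar> < g / (4 * L + 1)" for t
  proof -
    define B where "B = A + t *\<^sub>R Y"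
    define \<nu> where "\<nu> = ordered_eigenvalue B j"
    have B: "hermitian B"
      using A Y by (simp add: hermitian_def adjoint_matrix_def B_def vec_eq_iff)
    have \<nu>: "\<bar>\<nu> - \<mu>\<bar> \<le> L * \<bar>t\<bar>"
      using ordered_eigenvalue_lipschitz [OF B A j] by (simp add: B_def \<mu>_def \<nu>_def L_def mult_ac)
    obtain v where v1: "norm v = 1" and v: "B *v v = of_real \<nu> *s v"
      using ordered_eigenvalue_eigenvector [OF B j] by (auto simp: \<nu>_def)
    define a where "a = cinner v w"
    define x where "x = v - a *s w"
    have x: "cinner x w = 0"
      by (simp add: x_def a_def cinner_diff_left cinner_scale_left cinner_self w1)
    have Av: "A *v v = of_real \<nu> *s v - of_real t *s (Y *v v)"
      using v by (simp add: B_def matrix_vector_mult_add_rdistrib scaleR_matrix_vector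
          scaleR_eq_scale eq_diff_eq)
    have "A *v x - of_real \<mu> *s x = of_real (\<nu> - \<mu>) *s v - of_real t *s (Y *v v)"
      by (simp add: x_def matrix_vector_mult_diff_distrib vector_scalar_commute w [folded \<mu>_def] Av
          vec.scale_left_diff_distrib vec.scale_right_diff_distrib mult.commute)
    then have "norm (A *v x - of_real \<mu> *s x) \<le>
        norm (of_real (\<nu> - \<mu>) *s v) + norm (of_real t *s (Y *v v))"
      by (simp only: norm_triangle_ineq4)
    also have "\<dots> \<le> L * \<bar>t\<bar> + \<bar>t\<bar> * L"
      unfolding norm_scale norm_of_real using \<nu> L(2) [of v] v1
      by (intro add_mono mult_left_mono) simp_all
    finally have gx: "g * norm x \<le> 2 * L * \<bar>t\<bar>"
      using gap [OF x] by simp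
    have "\<bar>t\<bar> * (4 * L + 1) < g"
      using t L(1) by (simp add: pos_less_divide_eq)
    then have "4 * (L * \<bar>t\<bar>) \<le> g"
      by (simp add: algebra_simps)
    then have "g * norm x \<le> g * (1 / 2)"
      using gx by simp
    then have "norm x \<le> 1 / 2"
      using g by simp
    moreover have "norm v \<le> norm x + norm (a *s w)"
      using norm_triangle_ineq [of x "a *s w"] by (simp add: x_def)
    ultimately have a: "1 / 2 \<le> cmod a"
      by (simp add: norm_scale w1 v1)
    \<comment> \<open>Pairing with \<open>w\<close> moves \<open>A\<close> onto its eigenvector.
      Comparison with \<open>Av\<close> leaves as error only \<open>t\<close> times
      \<open>cinner (Y *v x) w\<close>, where \<open>x\<close> is already of order
      \<open>t\<close>.\<close>
    have "of_real \<mu> * a = cinner (A *v v) w"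
      by (simp add: cinner_hermitian [OF A] w [folded \<mu>_def] cinner_scale_right a_def)
    also have "\<dots> = of_real \<nu> * a - of_real t * cinner (Y *v v) w"
      by (simp add: Av cinner_diff_left cinner_scale_left a_def)
    also have "cinner (Y *v v) w = a * of_real D + cinner (Y *v x) w"
    proof -
      have "v = a *s w + x"
        by (simp add: x_def)
      then have "Y *v v = a *s (Y *v w) + Y *v x"
        by (metis matrix_vector_right_distrib vector_scalar_commute)
      then show ?thesis
        by (simp add: cinner_add_left cinner_scale_left D)
    qed
    finally have "of_real (\<nu> - \<mu> - D * t) * a = of_real t * cinner (Y *v x) w"
      by (simp add: algebra_simps)
    then have "\<bar>\<nu> - \<mu> - D * t\<bar> * cmod a = \<bar>t\<bar> * cmod (cinner (Y *v x) w)"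
      by (metis norm_mult norm_of_real)
    moreover have "cmod (cinner (Y *v x) w) \<le> L * norm x"
      using norm_cinner_le [of "Y *v x" w] L(2) [of x] w1 by simp
    moreover have "norm x \<le> 2 * L * \<bar>t\<bar> / g"
      using gx g by (simp add: pos_le_divide_eq mult.commute)
    then have "L * norm x \<le> L * (2 * L * \<bar>t\<bar> / g)"
      using L(1) by (intro mult_left_mono)
    ultimately have "\<bar>\<nu> - \<mu> - D * t\<bar> * cmod a \<le> \<bar>t\<bar> * (L * (2 * L * \<bar>t\<bar> / g))"
      by (metis abs_ge_zero mult_left_mono order_trans)
    also have "\<dots> = 2 * L\<^sup>2 / g * \<bar>t\<bar>\<^sup>2"
      by (simp add: power2_eq_square)
    also have "\<bar>t\<bar>\<^sup>2 = t\<^sup>2"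
      by simp
    finally have "\<bar>\<nu> - \<mu> - D * t\<bar> * cmod a \<le> 2 * L\<^sup>2 / g * t\<^sup>2" .
    moreover have "\<bar>\<nu> - \<mu> - D * t\<bar> * (1 / 2) \<le> \<bar>\<nu> - \<mu> - D * t\<bar> * cmod a"
      using a by (intro mult_left_mono) simp_all
    ultimately show ?thesis
      by (simp add: \<nu>_def B_def)
  qed
  show ?thesis
  proof (rule has_real_derivative_0_quadratic)
    show "0 < g / (4 * L + 1)"
      using g L(1) by (intro divide_pos_pos) simp_all
    show "\<bar>ordered_eigenvalue (A + t *\<^sub>R Y) j - ordered_eigenvalue (A + 0 *\<^sub>R Y) j
        - w \<bullet> (Y *v w) * t\<bar> \<le> (4 * L\<^sup>2 / g) * t\<^sup>2" if "\<bar>t\<bar> < g / (4 * L + 1)" for t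
      using bound [OF that] by (simp add: \<mu>_def D_def)
  qed
qed

section \<open>Matrix calculus\<close>

lemma adjoint_matrix_mult: "adjoint_matrix (A ** B) = adjoint_matrix B ** adjoint_matrix A"
  by (simp add: adjoint_matrix_def matrix_matrix_mult_def vec_eq_iff mult.commute)

lemma adjoint_matrix_add: "adjoint_matrix (A + B) = adjoint_matrix A + adjoint_matrix B"
  by (simp add: adjoint_matrix_def vec_eq_iff)

lemma adjoint_matrix_diff: "adjoint_matrix (A - B) = adjoint_matrix A - adjoint_matrix B"
  by (simp add: adjoint_matrix_def vec_eq_iff)

lemma adjoint_matrix_scaleR: "adjoint_matrix (t *\<^sub>R A) = t *\<^sub>R adjoint_matrix A"
  by (simp add: adjoint_matrix_def vec_eq_iff)

lemma adjoint_matrix_mat: "adjoint_matrix (mat c) = mat (cnj c)"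
  by (simp add: adjoint_matrix_def mat_def vec_eq_iff)

lemma adjoint_rank_one: "adjoint_matrix (rank_one w) = rank_one w"
  by (simp add: adjoint_matrix_def rank_one_def vec_eq_iff mult.commute)

text \<open>Complex multiples of matrices are written as products with the scalar matrix
  \<open>mat c\<close>; this rule reduces identities between them to algebra in the entries.\<close>

lemma mat_mult_nth: "(mat c ** A) $ a $ b = c * A $ a $ b"
  by (simp add: mat_def matrix_matrix_mult_def if_distrib [of "\<lambda>y. y * _"] cong: if_cong)

lemma mat_mult_commute: "A ** mat c = mat c ** (A :: complex^'d^'d)"
  by (simp add: vec_eq_iff mat_mult_nth)
    (simp add: mat_def matrix_matrix_mult_def if_distrib [of "\<lambda>y. _ * y"] mult.commute cong: if_cong)

lemma mat_mult_mat: "mat c ** mat d = (mat (c * d) :: complex^'d^'d)"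
  by (simp add: vec_eq_iff mat_mult_nth) (simp add: mat_def)

lemma mat_mult_left_commute: "A ** (mat c ** B) = mat c ** (A ** B)" for A B :: "complex^'d^'d"
  unfolding matrix_mul_assoc mat_mult_commute [of A c] ..

lemma matrix_mult_minus: "(- A) ** B = - (A ** B)" "A ** (- B) = - (A ** B)"
  for A B :: "complex^'d^'d"
  by (simp_all add: matrix_matrix_mult_def vec_eq_iff sum_negf)

lemma matrix_mult_diff: "(A - B) ** C = A ** C - B ** C" "C ** (A - B) = C ** A - C ** B"
  for A B :: "complex^'d^'d"
  by (simp_all add: matrix_matrix_mult_def vec_eq_iff sum_subtractf left_diff_distrib right_diff_distrib)

lemma matrix_mult_add: "(A + B) ** C = A ** C + B ** C" "C ** (A + B) = C ** A + C ** B"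
  for A B :: "complex^'d^'d"
  by (simp_all add: matrix_matrix_mult_def vec_eq_iff sum.distrib distrib_left distrib_right)

lemma bounded_bilinear_matrix_mult:
  "bounded_bilinear ((**) :: complex^'d^'d \<Rightarrow> complex^'d^'d \<Rightarrow> complex^'d^'d)"
proof -
  have "bilinear ((**) :: complex^'d^'d \<Rightarrow> complex^'d^'d \<Rightarrow> complex^'d^'d)"
    unfolding bilinear_def
    by (auto intro!: linearI simp: matrix_mult_add)
      (simp_all add: vec_eq_iff matrix_matrix_mult_def scaleR_sum_right)
  then show ?thesis
    by (simp add: bilinear_conv_bounded_bilinear)
qed

lemmas has_vector_derivative_matrix_mult =
  bounded_bilinear.has_vector_derivative [OF bounded_bilinear_matrix_mult]

lemmas matrix_mult_sum_left = bounded_bilinear.sum_left [OF bounded_bilinear_matrix_mult]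
  and matrix_mult_sum_right = bounded_bilinear.sum_right [OF bounded_bilinear_matrix_mult]

lemma commutator_sum_right: "commutator G (\<Sum>k\<in>K. f k) = (\<Sum>k\<in>K. commutator G (f k))"
  by (simp add: commutator_def matrix_mult_sum_left matrix_mult_sum_right sum_subtractf)

text \<open>The second identity is the adjoint of the first and keeps the same scalar because
  \<open>\<mu>\<close> is real.\<close>

lemma rank_one_mult_hermitian:
  assumes "hermitian A" "A *v w = of_real \<mu> *s w"
  shows "A ** rank_one w = mat (of_real \<mu>) ** rank_one w"
    and "rank_one w ** A = mat (of_real \<mu>) ** rank_one w"
proof -
  have "(\<Sum>b\<in>UNIV. A $ a $ b * w $ b) = of_real \<mu> * w $ a" for a
    using arg_cong [OF assms(2), of "\<lambda>y. y $ a"] by (simp add: matrix_vector_mult_def)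
  then show left: "A ** rank_one w = mat (of_real \<mu>) ** rank_one w"
    by (simp add: vec_eq_iff mat_mult_nth)
      (simp add: matrix_matrix_mult_def rank_one_def flip: mult.assoc sum_distrib_right)
  have "rank_one w ** A = adjoint_matrix (A ** rank_one w)"
    using assms(1) by (simp add: adjoint_matrix_mult adjoint_rank_one hermitian_def)
  then show "rank_one w ** A = mat (of_real \<mu>) ** rank_one w"
    by (simp add: left adjoint_matrix_mult adjoint_rank_one adjoint_matrix_mat mat_mult_commute)
qed

lemma rank_one_idem:
  assumes "norm w = 1"
  shows "rank_one w ** rank_one w = rank_one w"
proof -
  have "(\<Sum>b\<in>UNIV. cnj (w $ b) * w $ b) = 1"
    using cinner_self [of w] assms by (simp add: cinner_def mult.commute)
  moreover have "(rank_one w ** rank_one w) $ a $ c =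
      w $ a * cnj (w $ c) * (\<Sum>b\<in>UNIV. cnj (w $ b) * w $ b)" for a c
    by (simp add: matrix_matrix_mult_def rank_one_def sum_distrib_left mult_ac)
  ultimately show ?thesis
    by (simp add: vec_eq_iff rank_one_def)
qed

lemma matrix_rank_one_adjoint: "V ** rank_one w ** adjoint_matrix V = rank_one (V *v w)"
proof -
  have "(V ** rank_one w ** adjoint_matrix V) $ a $ c =
      (\<Sum>d\<in>UNIV. (\<Sum>b\<in>UNIV. V $ a $ b * w $ b) * cnj (w $ d) * cnj (V $ c $ d))" for a c
    by (simp add: matrix_matrix_mult_def rank_one_def adjoint_matrix_def sum_distrib_right mult.assoc)
  then show ?thesis
    by (simp add: vec_eq_iff rank_one_def matrix_vector_mult_def sum_distrib_left mult_ac)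
qed

section \<open>The gradient\<close>

lemma trace_rank_one:
  fixes Y :: "complex^'d^'d"
  shows "trace (rank_one w ** Y) = cinner (Y *v w) w"
proof -
  have "trace (rank_one w ** Y) = (\<Sum>a\<in>UNIV. \<Sum>b\<in>UNIV. w $ a * cnj (w $ b) * Y $ b $ a)"
    by (simp add: trace_def matrix_matrix_mult_def rank_one_def)
  also have "\<dots> = (\<Sum>b\<in>UNIV. \<Sum>a\<in>UNIV. w $ a * cnj (w $ b) * Y $ b $ a)"
    by (rule sum.swap)
  finally show ?thesis
    by (simp add: cinner_def matrix_vector_mult_def sum_distrib_left mult_ac)
qed

lemma skew_hermitian_i_rank_one: "skew_hermitian (mat \<i> ** rank_one w)"
  by (simp add: skew_hermitian_def adjoint_matrix_mult adjoint_rank_one adjoint_matrix_mat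
      mat_mult_commute) (simp add: vec_eq_iff mat_mult_nth)

text \<open>The factor \<open>\<i>\<close> makes the projection skew-Hermitian and at the same time
  turns the imaginary part of the trace into the real number \<open>w \<bullet> (Y *v w)\<close>,
  the derivative found above.\<close>

lemma has_gradient_ordered_eigenvalue:
  fixes A :: "complex^'d^'d"
  assumes "hermitian A" "1 \<le> j" "j \<le> CARD('d)"
    "simple_eigenvalue A (of_real (ordered_eigenvalue A j))"
    "norm w = 1" "A *v w = of_real (ordered_eigenvalue A j) *s w"
  shows "has_gradient (\<lambda>X. ordered_eigenvalue X j) A (mat \<i> ** rank_one w)"
  unfolding has_gradient_def
proof (intro conjI allI impI)
  fix Y :: "complex^'d^'d"
  assume Y: "hermitian Y"
  have "trace (mat \<i> ** rank_one w ** Y) = \<i> * trace (rank_one w ** Y)"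
    unfolding matrix_mul_assoc [symmetric] by (simp add: trace_def mat_mult_nth sum_distrib_left)
  then have "Im (trace (mat \<i> ** rank_one w ** Y)) = w \<bullet> (Y *v w)"
    by (simp add: trace_rank_one Re_cinner inner_commute)
  then show "((\<lambda>t. ordered_eigenvalue (A + t *\<^sub>R Y) j) has_real_derivative
      Im (trace (mat \<i> ** rank_one w ** Y))) (at 0)"
    using ordered_eigenvalue_derivative [OF assms(1) Y assms(2-6)] by simp
qed (rule skew_hermitian_i_rank_one)

text \<open>The Hermitian test direction \<open>\<i>\<close> times \<open>D = G - G'\<close> turns
  the equality of derivatives into the vanishing of the sum of
  \<open>(cmod (D $ a $ b))\<^sup>2\<close>. This identifies the gradient witnesses of an arbitrary
  integral curve.\<close>

lemma has_gradient_unique: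
  fixes G G' :: "complex^'d^'d"
  assumes "has_gradient f X G" "has_gradient f X G'"
  shows "G = G'"
proof -
  define D where "D = G - G'"
  define Y where "Y = mat \<i> ** D"
  have skew: "adjoint_matrix D = - D"
    using assms by (simp add: has_gradient_def skew_hermitian_def D_def adjoint_matrix_diff)
  have "hermitian Y"
    by (simp add: hermitian_def Y_def adjoint_matrix_mult adjoint_matrix_mat skew mat_mult_commute
        matrix_mult_minus) (simp add: vec_eq_iff mat_mult_nth)
  then have "Im (trace (G ** Y)) = Im (trace (G' ** Y))"
    using assms DERIV_unique unfolding has_gradient_def by blast
  then have "Im (trace (D ** Y)) = 0"
    by (simp add: D_def matrix_mult_diff trace_sub)
  moreover have "trace (D ** Y) = \<i> * trace (D ** D)"
    by (simp add: Y_def mat_mult_left_commute trace_def mat_mult_nth sum_distrib_left)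
  moreover have "trace (D ** D) = - (\<Sum>a\<in>UNIV. \<Sum>b\<in>UNIV. of_real ((cmod (D $ a $ b))\<^sup>2))"
  proof -
    have "D $ b $ a = - cnj (D $ a $ b)" for a b
      using arg_cong [OF skew, of "\<lambda>M. M $ b $ a"] by (simp add: adjoint_matrix_def)
    then have "D $ a $ b * D $ b $ a = - of_real ((cmod (D $ a $ b))\<^sup>2)" for a b
      unfolding complex_norm_square by (metis mult_minus_right)
    then show ?thesis
      by (simp add: trace_def matrix_matrix_mult_def sum_negf)
  qed
  ultimately have "(\<Sum>a\<in>UNIV. \<Sum>b\<in>UNIV. (cmod (D $ a $ b))\<^sup>2) = 0"
    by simp
  then have "D $ a $ b = 0" for a b
    by (simp add: sum_nonneg_eq_0_iff sum_nonneg)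
  then have "D = 0"
    by (simp add: vec_eq_iff)
  then show ?thesis
    by (simp add: D_def)
qed

section \<open>The unitary one-parameter group generated by an eigenprojection\<close>

text \<open>For a unit vector \<open>w\<close>: multiplication by \<open>z\<close> on the line of
  \<open>w\<close>, the identity on its orthocomplement. With \<open>z\<close> in place of an angle
  the group law is pure algebra, and periodicity sits entirely in \<open>cis\<close>.\<close>

definition phase_matrix :: "complex^'d \<Rightarrow> complex \<Rightarrow> complex^'d^'d" where
  "phase_matrix w z = mat 1 + mat (z - 1) ** rank_one w"

lemma phase_matrix_1 [simp]: "phase_matrix w 1 = mat 1"
  by (simp add: phase_matrix_def vec_eq_iff mat_mult_nth)

lemma adjoint_phase_matrix: "adjoint_matrix (phase_matrix w z) = phase_matrix w (cnj z)"
  by (simp add: phase_matrix_def adjoint_matrix_add adjoint_matrix_mult adjoint_rank_one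
      adjoint_matrix_mat mat_mult_commute)

lemma rank_one_phase_matrix:
  assumes "norm w = 1"
  shows "rank_one w ** phase_matrix w z = mat z ** rank_one w"
    and "phase_matrix w z ** rank_one w = mat z ** rank_one w"
  unfolding phase_matrix_def
  by (simp_all add: matrix_mult_add mat_mult_left_commute rank_one_idem [OF assms]
      flip: matrix_mul_assoc)
    (simp_all add: vec_eq_iff mat_mult_nth algebra_simps)

lemma phase_matrix_mult:
  assumes "norm w = 1"
  shows "phase_matrix w z ** phase_matrix w z' = phase_matrix w (z * z')"
proof -
  have "phase_matrix w z ** phase_matrix w z' =
      phase_matrix w z' + mat (z - 1) ** (rank_one w ** phase_matrix w z')"
    unfolding phase_matrix_def [of w z] by (simp add: matrix_mult_add matrix_mul_assoc)
  then show ?thesis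
    unfolding rank_one_phase_matrix [OF assms]
    by (simp add: phase_matrix_def vec_eq_iff mat_mult_nth algebra_simps)
qed

lemma phase_matrix_cis_inverse:
  assumes "norm w = 1"
  shows "phase_matrix w (cis t) ** phase_matrix w (cis (- t)) = mat 1"
    and "phase_matrix w (cis (- t)) ** phase_matrix w (cis t) = mat 1"
  by (simp_all add: phase_matrix_mult [OF assms] cis_mult)

text \<open>The phase matrix is a combination of the identity and a projection that commutes with
  \<open>A\<close>. Conjugating \<open>A\<close> by it therefore changes nothing, which is how the
  flow preserves the partial sum.\<close>

lemma phase_matrix_commute:
  assumes "hermitian A" "A *v w = of_real \<mu> *s w"
  shows "A ** phase_matrix w z = phase_matrix w z ** A"
proof -
  have "A ** (mat (z - 1) ** rank_one w) = mat (z - 1) ** (A ** rank_one w)"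
    by (rule mat_mult_left_commute)
  also have "A ** rank_one w = rank_one w ** A"
    by (simp only: rank_one_mult_hermitian [OF assms])
  finally show ?thesis
    by (simp add: phase_matrix_def matrix_mult_add matrix_mul_assoc)
qed

lemma has_vector_derivative_mat_mult:
  assumes "(f has_vector_derivative f') F"
  shows "((\<lambda>t. mat (f t) ** (M :: complex^'d^'d)) has_vector_derivative mat f' ** M) F"
proof -
  have "linear (\<lambda>c. mat c ** M)"
    by (intro linearI) (simp_all add: vec_eq_iff mat_mult_nth distrib_right)
  then show ?thesis
    using assms by (rule bounded_linear.has_vector_derivative [OF linear_conv_bounded_linear [THEN iffD1]])
qed

text \<open>The generator Q stands left of the first factor V and right of the second factor W. In
  \<open>V ** X ** W\<close> it then emerges on the outside as a commutator; in
  \<open>W ** X ** V\<close> it stands next to \<open>X\<close>, where it cancels against the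
  equation for \<open>X\<close>.\<close>

lemma has_vector_derivative_phase_matrix:
  assumes w: "norm w = 1"
  shows "((\<lambda>t. phase_matrix w (cis t)) has_vector_derivative
      mat \<i> ** rank_one w ** phase_matrix w (cis t)) (at t)"
    and "((\<lambda>t. phase_matrix w (cis (- t))) has_vector_derivative
      - (phase_matrix w (cis (- t)) ** (mat \<i> ** rank_one w))) (at t)"
proof -
  have "((\<lambda>t. cis t - 1) has_vector_derivative \<i> * cis t) (at t)"
    "((\<lambda>t. cis (- t) - 1) has_vector_derivative - (\<i> * cis (- t))) (at t)"
    by (auto intro!: derivative_eq_intros simp: has_vector_derivative_def)
  then have "((\<lambda>t. phase_matrix w (cis t)) has_vector_derivative mat (\<i> * cis t) ** rank_one w) (at t)"
    "((\<lambda>t. phase_matrix w (cis (- t))) has_vector_derivative mat (- (\<i> * cis (- t))) ** rank_one w) (at t)"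
    unfolding phase_matrix_def
    by (auto intro!: derivative_eq_intros has_vector_derivative_mat_mult)
  moreover have "mat \<i> ** rank_one w ** phase_matrix w (cis t) = mat (\<i> * cis t) ** rank_one w"
    unfolding matrix_mul_assoc [symmetric] rank_one_phase_matrix [OF w]
    by (simp add: matrix_mul_assoc mat_mult_mat)
  moreover have "- (phase_matrix w (cis (- t)) ** (mat \<i> ** rank_one w)) =
      mat (- (\<i> * cis (- t))) ** rank_one w"
    by (subst mat_mult_left_commute, subst rank_one_phase_matrix [OF w])
      (simp add: vec_eq_iff mat_mult_nth mult.assoc)
  ultimately show "((\<lambda>t. phase_matrix w (cis t)) has_vector_derivative
      mat \<i> ** rank_one w ** phase_matrix w (cis t)) (at t)"
    "((\<lambda>t. phase_matrix w (cis (- t))) has_vector_derivative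
      - (phase_matrix w (cis (- t)) ** (mat \<i> ** rank_one w))) (at t)"
    by metis+
qed

text \<open>Both directions conjugate with the one-parameter group, which turns the equation
  \<open>X' = [Q, X]\<close> into \<open>X' = 0\<close>.\<close>

lemma conjugation_solves_commutator_ode:
  fixes X :: "complex^'d^'d"
  assumes w: "norm w = 1"
  shows "((\<lambda>t. phase_matrix w (cis t) ** X ** phase_matrix w (cis (- t))) has_vector_derivative
    commutator (mat \<i> ** rank_one w) (phase_matrix w (cis t) ** X ** phase_matrix w (cis (- t)))) (at t)"
proof -
  define Q where "Q = mat \<i> ** rank_one w"
  define V W where "V = (\<lambda>t. phase_matrix w (cis t))" and "W = (\<lambda>t. phase_matrix w (cis (- t)))"
  have V: "(V has_vector_derivative Q ** V t) (at t)"
    and W: "(W has_vector_derivative - (W t ** Q)) (at t)"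
    unfolding V_def W_def Q_def by (rule has_vector_derivative_phase_matrix [OF w])+
  have "((\<lambda>t. V t ** X) has_vector_derivative V t ** 0 + Q ** V t ** X) (at t)"
    by (rule has_vector_derivative_matrix_mult [OF V has_vector_derivative_const])
  then have "((\<lambda>t. V t ** X ** W t) has_vector_derivative
      V t ** X ** (- (W t ** Q)) + (V t ** 0 + Q ** V t ** X) ** W t) (at t)"
    by (rule has_vector_derivative_matrix_mult [OF _ W])
  then have "((\<lambda>t. V t ** X ** W t) has_vector_derivative commutator Q (V t ** X ** W t)) (at t)"
    by (rule has_vector_derivative_eq_rhs)
      (simp add: commutator_def matrix_mult_minus matrix_mult_add matrix_mul_assoc)
  then show ?thesis
    unfolding V_def W_def Q_def .
qed

lemma commutator_ode_unique:
  fixes X :: "real \<Rightarrow> complex^'d^'d"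
  assumes w: "norm w = 1" and J: "is_interval J" "0 \<in> J" "t \<in> J"
    and X: "\<And>s. s \<in> J \<Longrightarrow> (X has_vector_derivative commutator (mat \<i> ** rank_one w) (X s)) (at s)"
  shows "X t = phase_matrix w (cis t) ** X 0 ** phase_matrix w (cis (- t))"
proof -
  define Q where "Q = mat \<i> ** rank_one w"
  define V W where "V = (\<lambda>t. phase_matrix w (cis t))" and "W = (\<lambda>t. phase_matrix w (cis (- t)))"
  have V: "(V has_vector_derivative Q ** V s) (at s)"
    and W: "(W has_vector_derivative - (W s ** Q)) (at s)" for s
    unfolding V_def W_def Q_def by (rule has_vector_derivative_phase_matrix [OF w])+
  define Z where "Z = (\<lambda>s. W s ** X s ** V s)"
  have "(Z has_vector_derivative 0) (at s)" if "s \<in> J" for s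
  proof -
    have "((\<lambda>s. W s ** X s) has_vector_derivative
        W s ** commutator Q (X s) + - (W s ** Q) ** X s) (at s)"
      using X [OF that] unfolding Q_def [symmetric] by (rule has_vector_derivative_matrix_mult [OF W])
    then have "(Z has_vector_derivative W s ** X s ** (Q ** V s) +
        (W s ** commutator Q (X s) + - (W s ** Q) ** X s) ** V s) (at s)"
      unfolding Z_def by (rule has_vector_derivative_matrix_mult [OF _ V])
    then show ?thesis
      by (rule has_vector_derivative_eq_rhs)
        (simp add: commutator_def matrix_mult_minus matrix_mult_diff matrix_mult_add matrix_mul_assoc)
  qed
  then have "\<exists>c. \<forall>s\<in>J. Z s = c"
    using has_vector_derivative_zero_constant [of J Z] is_interval_convex [OF J(1)]
    by (metis has_vector_derivative_at_within)
  then have "Z t = Z 0"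
    using J by metis
  also have "\<dots> = X 0"
    by (simp add: Z_def V_def W_def)
  finally have Z: "Z t = X 0" .
  have VW: "V t ** W t = mat 1"
    unfolding V_def W_def by (rule phase_matrix_cis_inverse [OF w])
  have "X t = (V t ** W t) ** X t ** (V t ** W t)"
    unfolding VW by simp
  also have "\<dots> = V t ** Z t ** W t"
    by (simp only: Z_def matrix_mul_assoc)
  finally show ?thesis
    by (simp only: Z V_def W_def)
qed

section \<open>The Hamiltonian flow of an eigenvalue\<close>

lemma orbit_hermitian: "X \<in> orbit r \<Longrightarrow> hermitian X"
  by (auto simp: orbit_def hermitian_def adjoint_matrix_scaleR adjoint_rank_one)

lemma partial_sum_hermitian:
  assumes "e \<in> orbit_product n r" "i + 1 \<le> n"
  shows "hermitian (partial_sum i e)"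
proof -
  have "hermitian (e k)" if "k \<in> {1..i+1}" for k
    using assms that by (intro orbit_hermitian [of _ "r k"]) (auto simp: orbit_product_def)
  then have "hermitian (\<Sum>k\<in>K. e k)" if "K \<subseteq> {1..i+1}" for K
    using that
    by (induction K rule: infinite_finite_induct)
      (auto simp: hermitian_def adjoint_matrix_add, simp_all add: adjoint_matrix_def vec_eq_iff)
  then show ?thesis
    by (simp only: partial_sum_def order_refl)
qed

text \<open>Shaped for \<open>has_gradient\<close> in a single variable: that gradient is the
  gradient at the whole partial sum if the variable occurs in it, and zero otherwise.\<close>

lemma partial_sum_update:
  "partial_sum i (e(k := e k + Y)) = partial_sum i e + (if k \<in> {1..i+1} then Y else 0)"
proof -
  have "partial_sum i (e(k := e k + Y)) = partial_sum i e + (\<Sum>l\<in>{1..i+1}. if l = k then Y else 0)"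
    unfolding partial_sum_def sum.distrib [symmetric] by (intro sum.cong) auto
  then show ?thesis
    by (simp only: sum.delta finite_atLeastAtMost)
qed

text \<open>The choice depends on the matrix alone, so tuples with equal partial sums receive the
  same vector, phase included.\<close>

definition eigenvector :: "complex^'d^'d \<Rightarrow> nat \<Rightarrow> complex^'d" where
  "eigenvector A j = (SOME w. norm w = 1 \<and> A *v w = of_real (ordered_eigenvalue A j) *s w)"

lemma eigenvector:
  fixes A :: "complex^'d^'d"
  assumes "hermitian A" "1 \<le> j" "j \<le> CARD('d)"
  shows "norm (eigenvector A j) = 1"
    and "A *v eigenvector A j = of_real (ordered_eigenvalue A j) *s eigenvector A j"
  using someI_ex [OF ordered_eigenvalue_eigenvector [OF assms]] by (simp_all add: eigenvector_def)

text \<open>The axis \<open>w\<close> is taken from the initial tuple, which is legitimate because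
  the partial sum turns out to be conserved. Components outside the sum stay put, so the value
  \<open>undefined\<close> outside \<open>{1..n}\<close> is preserved too.\<close>

definition eigenvalue_flow ::
  "nat \<Rightarrow> nat \<Rightarrow> real \<Rightarrow> (nat \<Rightarrow> complex^'d^'d) \<Rightarrow> nat \<Rightarrow> complex^'d^'d" where
  "eigenvalue_flow i j t e =
    (let w = eigenvector (partial_sum i e) j in
     (\<lambda>k. if k \<in> {1..i+1} then phase_matrix w (cis t) ** e k ** phase_matrix w (cis (- t)) else e k))"

lemma eigenvalue_flow_unmoved: "k \<notin> {1..i+1} \<Longrightarrow> eigenvalue_flow i j t e k = e k"
  unfolding eigenvalue_flow_def Let_def by (rule if_not_P)

lemma eigenvalue_flow_moved:
  assumes "k \<in> {1..i+1}" "w = eigenvector (partial_sum i e) j"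
  shows "eigenvalue_flow i j t e k = phase_matrix w (cis t) ** e k ** phase_matrix w (cis (- t))"
  unfolding eigenvalue_flow_def Let_def assms(2) using assms(1) by (rule if_P)

lemma eigenvalue_flow_periodic: "eigenvalue_flow i j (t + 2 * pi) e = eigenvalue_flow i j t e"
proof -
  have "cis (t + 2 * pi) = cis t" "cis (- (t + 2 * pi)) = cis (- t)"
    by (simp_all add: complex_eq_iff cos_diff sin_diff)
  then show ?thesis
    by (simp only: eigenvalue_flow_def)
qed

lemma eigenvalue_flow_0: "eigenvalue_flow i j 0 e = e"
  by (simp add: eigenvalue_flow_def Let_def fun_eq_iff)

text \<open>The phase matrix is unitary, so conjugation carries the projection onto the line of
  \<open>v\<close> to the projection onto the line of its image, which is again a unit
  vector.\<close>

lemma orbit_conjugate: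
  assumes "norm w = 1" "X \<in> orbit r"
  shows "phase_matrix w (cis t) ** X ** phase_matrix w (cis (- t)) \<in> orbit r"
proof -
  obtain v where v: "X = r *\<^sub>R rank_one v" "norm v = 1"
    using assms(2) by (auto simp: orbit_def)
  define V where "V = phase_matrix w (cis t)"
  have adj: "adjoint_matrix V = phase_matrix w (cis (- t))"
    by (simp add: V_def adjoint_phase_matrix cis_cnj)
  have "cinner (V *v v) (V *v v) = cinner v (adjoint_matrix V *v (V *v v))"
    by (rule cinner_matrix_left)
  also have "\<dots> = cinner v v"
    by (simp add: adj matrix_vector_mul_assoc) (simp add: V_def phase_matrix_cis_inverse [OF assms(1)])
  finally have "(norm (V *v v))\<^sup>2 = 1"
    unfolding cinner_self v(2) by (simp only: of_real_eq_iff) simp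
  then have "norm (V *v v) = 1"
    by (metis norm_ge_zero power2_eq_1_iff real_sqrt_pow2 real_sqrt_unique abs_of_nonneg abs_square_eq_1)
  moreover have "V ** X ** adjoint_matrix V = r *\<^sub>R rank_one (V *v v)"
    unfolding matrix_rank_one_adjoint [symmetric] v(1)
    by (simp add: matrix_scalar_ac flip: scalar_matrix_assoc)
  ultimately show ?thesis
    unfolding V_def [symmetric] adj [symmetric] orbit_def by blast
qed

context
  fixes n i j :: nat and r :: "nat \<Rightarrow> real"
  assumes i: "i + 1 \<le> n" and j: "1 \<le> j" "j \<le> CARD('d::finite)"
begin

private abbreviation (input) U :: "(nat \<Rightarrow> complex^'d^'d) set" where
  "U \<equiv> simple_locus n r i j"

lemma simple_locus_iff:
  "e \<in> U \<longleftrightarrow> e \<in> orbit_product n r \<and>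
    simple_eigenvalue (partial_sum i e) (of_real (ordered_eigenvalue (partial_sum i e) j))"
  by (simp add: simple_locus_def lam_def)

lemma hermitian_simple_locus: "e \<in> U \<Longrightarrow> hermitian (partial_sum i e)"
  using partial_sum_hermitian [OF _ i] by (auto simp: simple_locus_iff)

text \<open>In the product topology \<open>partial_sum i\<close> is a finite sum of coordinate maps,
  hence continuous, and pulls the ball around a matrix with simple eigenvalue back to an open set of
  tuples.\<close>

lemma simple_locus_open: "openin (top_of_set (orbit_product n r)) U"
proof (subst openin_subopen, intro ballI)
  fix e :: "nat \<Rightarrow> complex^'d^'d"
  assume e: "e \<in> U"
  then have A: "hermitian (partial_sum i e)"
    by (rule hermitian_simple_locus)
  then obtain \<epsilon> where \<epsilon>: "0 < \<epsilon>" and near: "\<And>B. hermitian B \<Longrightarrow> norm (partial_sum i e - B) < \<epsilon> \<Longrightarrow>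
      simple_eigenvalue B (of_real (ordered_eigenvalue B j))"
    using simple_eigenvalue_open [OF A j] e by (auto simp: simple_locus_iff)
  define T where "T = {e'. norm (partial_sum i e - partial_sum i e') < \<epsilon>}"
  have "continuous_on UNIV (partial_sum i :: (nat \<Rightarrow> complex^'d^'d) \<Rightarrow> _)"
    unfolding partial_sum_def by (intro continuous_on_sum continuous_on_product_coordinates)
  then have "open T"
    unfolding T_def by (intro open_Collect_less continuous_intros)
  moreover have "orbit_product n r \<inter> T \<subseteq> U"
    by (auto simp: simple_locus_iff T_def intro!: near partial_sum_hermitian [OF _ i])
  moreover have "e \<in> orbit_product n r \<inter> T"
    using e \<epsilon> by (simp add: simple_locus_iff T_def)
  ultimately show "\<exists>S. openin (top_of_set (orbit_product n r)) S \<and> e \<in> S \<and> S \<subseteq> U"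
    by (meson openin_open_Int)
qed

lemma has_gradient_lam:
  assumes "e \<in> U"
  shows "has_gradient (\<lambda>X. lam i j (e(k := X))) (e k)
    (if k \<in> {1..i+1} then mat \<i> ** rank_one (eigenvector (partial_sum i e) j) else 0)"
proof -
  have A: "hermitian (partial_sum i e)"
    using assms by (rule hermitian_simple_locus)
  have grad: "has_gradient (\<lambda>X. ordered_eigenvalue X j) (partial_sum i e)
      (mat \<i> ** rank_one (eigenvector (partial_sum i e) j))"
    using assms by (intro has_gradient_ordered_eigenvalue A j eigenvector) (simp add: simple_locus_iff)
  show ?thesis
  proof (cases "k \<in> {1..i+1}")
    case True
    then show ?thesis
      using grad unfolding has_gradient_def lam_def partial_sum_update by simp
  next
    case False
    have "has_gradient (\<lambda>X. lam i j (e(k := X))) (e k) 0"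
      unfolding has_gradient_def lam_def partial_sum_update if_not_P [OF False]
      by (simp add: skew_hermitian_def adjoint_matrix_def vec_eq_iff trace_def)
    then show ?thesis
      by (simp only: if_not_P [OF False])
  qed
qed

lemma commutator_eigenprojection:
  assumes "e \<in> U"
  shows "commutator (mat \<i> ** rank_one (eigenvector (partial_sum i e) j)) (partial_sum i e) = 0"
proof -
  have A: "hermitian (partial_sum i e)"
    using assms by (rule hermitian_simple_locus)
  show ?thesis
    unfolding commutator_def mat_mult_left_commute matrix_mul_assoc [symmetric]
    by (simp add: rank_one_mult_hermitian [OF A eigenvector(2) [OF A j]])
qed

text \<open>All summands are conjugated by one phase matrix, which commutes with their sum.
  Consequently the gradient keeps its initial value along the explicit flow.\<close>

lemma partial_sum_eigenvalue_flow:
  assumes "e \<in> U"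
  shows "partial_sum i (eigenvalue_flow i j t e) = partial_sum i e"
proof -
  define A where "A = partial_sum i e"
  define w where "w = eigenvector A j"
  have A: "hermitian A"
    unfolding A_def using assms by (rule hermitian_simple_locus)
  have conj: "phase_matrix w (cis t) ** (\<Sum>k\<in>K. e k) ** phase_matrix w (cis (- t)) =
      (\<Sum>k\<in>K. phase_matrix w (cis t) ** e k ** phase_matrix w (cis (- t)))" for K
    by (simp only: matrix_mult_sum_left matrix_mult_sum_right)
  have "partial_sum i (eigenvalue_flow i j t e) =
      phase_matrix w (cis t) ** A ** phase_matrix w (cis (- t))"
    unfolding A_def partial_sum_def conj
    by (intro sum.cong) (simp_all add: eigenvalue_flow_def Let_def w_def A_def partial_sum_def)
  also have "\<dots> = A ** (phase_matrix w (cis t) ** phase_matrix w (cis (- t)))"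
    by (simp only: w_def phase_matrix_commute [OF A eigenvector(2) [OF A j]] matrix_mul_assoc)
  also have "\<dots> = A"
    using phase_matrix_cis_inverse(1) [OF eigenvector(1) [OF A j]] by (simp add: w_def)
  finally show ?thesis
    by (simp add: A_def)
qed

lemma eigenvalue_flow_in_simple_locus:
  assumes "e \<in> U"
  shows "eigenvalue_flow i j t e \<in> U"
proof -
  have A: "hermitian (partial_sum i e)"
    using assms by (rule hermitian_simple_locus)
  have "eigenvalue_flow i j t e \<in> orbit_product n r"
    unfolding orbit_product_def
  proof (rule PiE_I)
    fix k assume "k \<in> {1..n}"
    then have "e k \<in> orbit (r k)"
      using assms unfolding simple_locus_iff orbit_product_def by blast
    then show "eigenvalue_flow i j t e k \<in> orbit (r k)"
      using orbit_conjugate [OF eigenvector(1) [OF A j]]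
      by (metis eigenvalue_flow_moved eigenvalue_flow_unmoved)
  next
    fix k assume k: "k \<notin> {1..n}"
    then have "eigenvalue_flow i j t e k = e k"
      using i by (intro eigenvalue_flow_unmoved) auto
    also have "e k = undefined"
      using assms k unfolding simple_locus_iff orbit_product_def by (blast intro: PiE_arb)
    finally show "eigenvalue_flow i j t e k = undefined" .
  qed
  then show ?thesis
    using assms by (simp add: simple_locus_iff partial_sum_eigenvalue_flow)
qed

section \<open>Existence and uniqueness of integral curves\<close>

lemma hamiltonian_curve_eigenvalue_flow:
  assumes "e \<in> U"
  shows "hamiltonian_curve n (lam i j) U UNIV (\<lambda>t. eigenvalue_flow i j t e)"
  unfolding hamiltonian_curve_def
proof (intro conjI ballI)
  fix t
  show mem: "eigenvalue_flow i j t e \<in> U"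
    using assms by (rule eigenvalue_flow_in_simple_locus)
  have A: "hermitian (partial_sum i e)"
    using assms by (rule hermitian_simple_locus)
  fix k
  show "\<exists>G. has_gradient (\<lambda>X. lam i j ((eigenvalue_flow i j t e)(k := X))) (eigenvalue_flow i j t e k) G \<and>
      ((\<lambda>s. eigenvalue_flow i j s e k) has_vector_derivative
        commutator G (eigenvalue_flow i j t e k)) (at t)"
  proof (intro exI conjI, rule has_gradient_lam [OF mem])
    show "((\<lambda>s. eigenvalue_flow i j s e k) has_vector_derivative
        commutator (if k \<in> {1..i+1} then
          mat \<i> ** rank_one (eigenvector (partial_sum i (eigenvalue_flow i j t e)) j) else 0)
        (eigenvalue_flow i j t e k)) (at t)"
      \<comment> \<open>The gradient refers to the eigenvector at time \<open>t\<close>;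
        conservation replaces it by the initial one, so the equation has constant
        coefficients.\<close>
      unfolding partial_sum_eigenvalue_flow [OF assms]
    proof (cases "k \<in> {1..i+1}")
      case True
      then show "((\<lambda>s. eigenvalue_flow i j s e k) has_vector_derivative
          commutator (if k \<in> {1..i+1} then mat \<i> ** rank_one (eigenvector (partial_sum i e) j) else 0)
          (eigenvalue_flow i j t e k)) (at t)"
        using conjugation_solves_commutator_ode [OF eigenvector(1) [OF A j]]
        by (simp only: eigenvalue_flow_moved if_True)
    next
      case False
      show "((\<lambda>s. eigenvalue_flow i j s e k) has_vector_derivative
          commutator (if k \<in> {1..i+1} then mat \<i> ** rank_one (eigenvector (partial_sum i e) j) else 0)
          (eigenvalue_flow i j t e k)) (at t)"
        unfolding if_not_P [OF False] eigenvalue_flow_unmoved [OF False]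
        by (simp add: commutator_def)
    qed
  qed
qed simp_all

text \<open>The partial sum is shown to be constant while the generator \<open>Q s\<close> may still
  vary with the curve, since \<open>Q s\<close> commutes with the partial sum at time
  \<open>s\<close>. Only then is \<open>Q\<close> known to be constant and each component determined
  by its own linear equation.\<close>

lemma hamiltonian_curve_unique:
  assumes c: "hamiltonian_curve n (lam i j) U J c" and J: "0 \<in> J" "t \<in> J"
  shows "c t = eigenvalue_flow i j t (c 0)"
proof -
  define Q where "Q = (\<lambda>s. mat \<i> ** rank_one (eigenvector (partial_sum i (c s)) j))"
  have interval: "is_interval J"
    using c by (simp add: hamiltonian_curve_def)
  have U: "c s \<in> U" if "s \<in> J" for s
    using c that by (simp add: hamiltonian_curve_def)
  have deriv: "((\<lambda>s. c s k) has_vector_derivative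
      commutator (if k \<in> {1..i+1} then Q s else 0) (c s k)) (at s)" if s: "s \<in> J" and k: "k \<in> {1..n}" for s k
  proof -
    obtain G where G: "has_gradient (\<lambda>X. lam i j ((c s)(k := X))) (c s k) G"
      "((\<lambda>s. c s k) has_vector_derivative commutator G (c s k)) (at s)"
      using c s k unfolding hamiltonian_curve_def by blast
    moreover have "G = (if k \<in> {1..i+1} then Q s else 0)"
      unfolding Q_def by (rule has_gradient_unique [OF G(1) has_gradient_lam [OF U [OF s]]])
    ultimately show ?thesis
      by simp
  qed
  have const: "f s = f 0" if "\<And>s. s \<in> J \<Longrightarrow> (f has_vector_derivative 0) (at s)" "s \<in> J"
    for f :: "real \<Rightarrow> complex^'d^'d" and s
  proof -
    have "\<exists>c. \<forall>s\<in>J. f s = c"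
      using has_vector_derivative_zero_constant [of J f] is_interval_convex [OF interval] that(1)
      by (metis has_vector_derivative_at_within)
    then show ?thesis
      using J(1) that(2) by metis
  qed
  have "((\<lambda>s. partial_sum i (c s)) has_vector_derivative 0) (at s)" if s: "s \<in> J" for s
  proof -
    have "((\<lambda>s. \<Sum>k\<in>{1..i+1}. c s k) has_vector_derivative
        (\<Sum>k\<in>{1..i+1}. commutator (Q s) (c s k))) (at s)"
    proof (rule has_vector_derivative_sum)
      fix k assume k: "k \<in> {1..i+1}"
      then have "k \<in> {1..n}"
        using i by simp
      from deriv [OF s this] k show "((\<lambda>s. c s k) has_vector_derivative commutator (Q s) (c s k)) (at s)"
        by simp
    qed
    moreover have "(\<Sum>k\<in>{1..i+1}. commutator (Q s) (c s k)) = 0"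
      using commutator_eigenprojection [OF U [OF s]]
      by (simp only: Q_def commutator_sum_right partial_sum_def)
    ultimately show ?thesis
      by (simp only: partial_sum_def)
  qed
  then have sum: "partial_sum i (c s) = partial_sum i (c 0)" if "s \<in> J" for s
    using const [of "\<lambda>s. partial_sum i (c s)"] that by blast
  define w where "w = eigenvector (partial_sum i (c 0)) j"
  have Q: "Q s = mat \<i> ** rank_one w" if "s \<in> J" for s
    by (simp only: Q_def w_def sum [OF that])
  have w: "norm w = 1"
    unfolding w_def using U [OF J(1)] by (intro eigenvector j hermitian_simple_locus)
  show ?thesis
  proof
    fix k
    consider "k \<in> {1..i+1}" | "k \<in> {1..n}" "k \<notin> {1..i+1}" | "k \<notin> {1..n}" "k \<notin> {1..i+1}"
      by blast
    then show "c t k = eigenvalue_flow i j t (c 0) k"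
    proof cases
      case 1
      then have "k \<in> {1..n}"
        using i by simp
      have "c t k = phase_matrix w (cis t) ** c 0 k ** phase_matrix w (cis (- t))"
      proof (rule commutator_ode_unique [OF w interval J])
        fix s assume "s \<in> J"
        then show "((\<lambda>s. c s k) has_vector_derivative commutator (mat \<i> ** rank_one w) (c s k)) (at s)"
          using deriv [OF _ \<open>k \<in> {1..n}\<close>] 1 by (simp add: Q)
      qed
      then show ?thesis
        by (simp only: eigenvalue_flow_moved [OF 1 w_def])
    next
      case 2
      have "((\<lambda>s. c s k) has_vector_derivative 0) (at s)" if "s \<in> J" for s
        using deriv [OF that 2(1)] 2(2) by (simp add: commutator_def split: if_splits)
      then have "c t k = c 0 k"
        using const [of "\<lambda>s. c s k"] J(2) by blast
      then show ?thesis
        by (simp only: eigenvalue_flow_unmoved [OF 2(2)])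
    next
      \<comment> \<open>No equation governs these components; membership in the orbit product makes
        both values \<open>undefined\<close>.\<close>
      case 3
      then have "c t k = c 0 k"
        using U [OF J(1)] U [OF J(2)] unfolding simple_locus_iff orbit_product_def
        by (metis PiE_arb)
      then show ?thesis
        by (simp only: eigenvalue_flow_unmoved [OF 3(2)])
    qed
  qed
qed

end

theorem corollary5p1p4:
  fixes m n i j :: nat and r :: "nat \<Rightarrow> real" and U :: "(nat \<Rightarrow> complex^'d^'d) set"
  assumes "m \<ge> 1" and "CARD('d) = m + 1" and "n \<ge> 4"
    and "\<And>k. k \<in> {1..n} \<Longrightarrow> r k > 0"
    and "1 \<le> i" and "i \<le> n - 3" and "1 \<le> j" and "j \<le> m + 1"
    and "U = simple_locus n r i j"
  shows "openin (top_of_set (orbit_product n r)) U \<and>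
    (\<exists>\<phi>. hamiltonian_flow n (lam i j) U \<phi> \<and> (\<forall>t. \<forall>e\<in>U. \<phi> (t + 2 * pi) e = \<phi> t e))"
proof -
  have i: "i + 1 \<le> n" and j: "1 \<le> j" "j \<le> CARD('d)"
    using assms by linarith+
  \<comment> \<open>Since \<open>hamiltonian_flow\<close> determines its flow on \<open>U\<close>,
    exhibiting the explicit formula as a flow transfers the periodicity of \<open>cis\<close> to the
    flow itself.\<close>
  have "hamiltonian_flow n (lam i j) U (eigenvalue_flow i j)"
    unfolding hamiltonian_flow_def assms(9)
    using eigenvalue_flow_0 hamiltonian_curve_eigenvalue_flow [OF i j] hamiltonian_curve_unique [OF i j]
    by blast
  then show ?thesis
    using simple_locus_open [OF i j] eigenvalue_flow_periodic assms(9) by blast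
qed

end
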